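(* Let $sE-A\in\mathbb{K}[s]^{n\times n}$ be such that $\operatorname{ran}\begin{bmatrix}E\\ A\end{bmatrix}=\mathcal{D}\mathcal{L}$ for some dissipative linear relation $\mathcal{D}\subseteq\mathbb{K}^{2n}$ and some symmetric linear relation $\mathcal{L}\subseteq\mathbb{K}^{2n}$. If $\operatorname{mul}\mathcal{D}\cap\ker\mathcal{L}=\{0\}$, then there exist a unitary matrix $U\in\mathbb{K}^{n\times n}$ and an invertible matrix $T\in\mathbb{K}^{n\times n}$ such that, for some $n_1,n_2\in\mathbb{N}$, $$U^*(sE-A)T=\begin{bmatrix}sL_{11}-D_{11}&0\\ sL_{21}-D_{21}&sL_{22}-D_{22}\end{bmatrix}$$ with $L_{ij},D_{ij}\in\mathbb{K}^{n_i\times n_j}$, satisfying $L_{11}=L_{11}^*$, $D_{11}+D_{11}^*\le0$, $L_{22}=L_{22}^2=L_{22}^*$ and $-D_{22}=D_{22}^2=-D_{22}^*$. Moreover, $sE-A$ is regular if, and only if, the following two conditions hold: (i) $sL_{11}-D_{11}$ is regular, and (ii) $\ker\mathcal{L}+\operatorname{mul}\mathcal{D}=(\operatorname{ran}\mathcal{L})^{\perp}+(\operatorname{dom}\mathcal{D})^{\perp}$.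
   Context: $\mathbb{K}\in\{\mathbb{R},\mathbb{C}\}$; $\mathbb{N}$ includes $0$ (blocks of size zero are allowed, and the empty $0\times 0$ pencil counts as regular). $\mathbb{K}^n$ carries the inner product $\langle x,y\rangle=y^*x$. For a square matrix $M$, $M\le0$ means that $M$ is Hermitian and negative semi-definite. A linear relation in $\mathbb{K}^n$ is a linear subspace $\mathcal{M}$ of $\mathbb{K}^{2n}\cong\mathbb{K}^n\times\mathbb{K}^n$. Its domain, kernel, range and multi-valued part are $\operatorname{dom}\mathcal{M}=\{x:\exists y,\ (x,y)\in\mathcal{M}\}$, $\ker\mathcal{M}=\{x:(x,0)\in\mathcal{M}\}$, $\operatorname{ran}\mathcal{M}=\{y:\exists x,\ (x,y)\in\mathcal{M}\}$, $\operatorname{mul}\mathcal{M}=\{y:(0,y)\in\mathcal{M}\}$. The product is $\mathcal{D}\mathcal{L}=\{(x,z) : \exists y\in\mathbb{K}^n,\ (x,y)\in\mathcal{L},\ (y,z)\in\mathcal{D}\}$. The adjoint is $\mathcal{M}^*=\{(x,y)\in\mathbb{K}^{2n} : \langle w,x\rangle=\langle v,y\rangle\ \forall (v,w)\in\mathcal{M}\}$. $\mathcal{M}$ is symmetric if $\mathcal{M}\subseteq\mathcal{M}^*$, and dissipative if $\operatorname{Re}\langle x,y\rangle\le 0$ for all $(x,y)\in\mathcal{M}$. Sums in (ii) are sums of subspaces of $\mathbb{K}^n$. A square pencil $sE-A$ is regular if $\det(sE-A)$ is not the zero polynomial. The regularity characterization refers to the blocks of the block-triangular form whose existence is asserted.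 *)

theory Defs
  imports Complex_Main "Jordan_Normal_Form.Schur_Decomposition"
begin

text \<open>
  The ground field: a type class whose models are exactly \<open>\<real>\<close> and \<open>\<complex>\<close>, each with its usual
  conjugation, real part and absolute value (see the two instances and
  \<open>real_or_complex_dichotomy\<close> below).
  The order of \<open>conjugatable_ordered_field\<close> (for \<open>\<complex>\<close> the partial order of
  \<open>HOL-Library.Complex_Order\<close>) is only there to make the Gram-Schmidt theory available; no
  definition below refers to it.
\<close>

class real_or_complex = conjugatable_ordered_field + real_normed_field +
  fixes re :: "'a \<Rightarrow> real"
  assumes scaleR_re: "re x *\<^sub>R 1 = (x + conjugate x) / 2"
    and scaleR_norm: "(norm x)\<^sup>2 *\<^sub>R 1 = x * conjugate x"

instantiation real :: real_or_complex
begin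
definition re_real: "re (x :: real) = x"
instance by intro_classes (simp_all add: re_real power2_eq_square)
end

instantiation complex :: real_or_complex
begin
definition re_complex: "re (z :: complex) = Re z"
instance
proof intro_classes
  fix x :: complex
  show "re x *\<^sub>R 1 = (x + conjugate x) / 2"
    by (simp add: re_complex complex_eq_iff)
  show "(norm x)\<^sup>2 *\<^sub>R 1 = x * conjugate x"
    by (simp only: conjugate_complex_def complex_norm_square flip: of_real_def)
qed
end

lemma of_real_re: "of_real (re x) = (x + conjugate x) / 2"
  for x :: "'a :: real_or_complex"
  by (simp only: of_real_def scaleR_re)

lemma mult_conjugate_norm: "x * conjugate x = of_real ((norm x)\<^sup>2)"
  for x :: "'a :: real_or_complex"
  by (simp only: of_real_def scaleR_norm)

lemma real_or_complex_dichotomy: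
  "(\<forall>x :: 'a :: real_or_complex. x = of_real (re x) \<and> conjugate x = x) \<or>
   (\<exists>i :: 'a. i * i = - 1 \<and> conjugate i = - i \<and>
      (\<forall>x. \<exists>a b. x = of_real a + of_real b * i))"
proof (cases "\<forall>x :: 'a. conjugate x = x")
  case True
  then show ?thesis by (simp add: of_real_re)
next
  case False
  have fixed: "x = of_real (re x)" if "conjugate x = x" for x :: 'a
    using that by (simp add: of_real_re)
  have conj_of_real: "conjugate (of_real r :: 'a) = of_real r" for r
  proof (cases "r = 0")
    case False
    have "(of_real r :: 'a) * conjugate (of_real r) = of_real r * of_real r"
      by (simp add: mult_conjugate_norm power2_eq_square)
    then show ?thesis using False by simp
  qed simp
  from False obtain x :: 'a where x: "conjugate x \<noteq> x" by blast
  define y where "y = x - conjugate x"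
  have cy: "conjugate y = - y"
    unfolding y_def using conjugate_dist_add[of x "- conjugate x"] by (simp add: conjugate_neg)
  have y0: "y \<noteq> 0" using x by (simp add: y_def)
  define i where "i = y / of_real (norm y)"
  have yi: "y = of_real (norm y) * i" using y0 by (simp add: i_def)
  have ci: "conjugate i = - i"
  proof -
    have "of_real (norm y) * conjugate i = of_real (norm y) * - i"
      using cy yi by (metis conj_of_real conjugate_dist_mul mult_minus_right)
    moreover have "(of_real (norm y) :: 'a) \<noteq> 0" using y0 by simp
    ultimately show ?thesis using mult_left_cancel by blast
  qed
  have ni: "norm i = 1" using y0 by (simp add: i_def norm_divide)
  have ii: "i * i = - 1"
    using mult_conjugate_norm[of i] ci ni by (simp add: equation_minus_iff)
  have "\<exists>a b. z = of_real a + of_real b * i" for z :: 'a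
  proof -
    define w where "w = - (i * (z - conjugate z) / 2)"
    have two: "conjugate (2 :: 'a) = 2" using conj_of_real[of 2] by simp
    have cdiff: "conjugate (z - conjugate z) = - (z - conjugate z)"
      using conjugate_dist_add[of z "- conjugate z"] by (simp add: conjugate_neg)
    have "2 * w = - (i * (z - conjugate z))" by (simp add: w_def)
    then have "2 * conjugate w = 2 * w"
      by (metis two ci cdiff conjugate_dist_mul conjugate_neg minus_mult_minus)
    then have "conjugate w = w" by simp
    then have w: "w = of_real (re w)" by (rule fixed)
    have "w * i = - ((i * i) * (z - conjugate z) / 2)" by (simp add: w_def algebra_simps)
    then have "w * i = (z - conjugate z) / 2"
      by (simp only: ii mult_minus1 minus_divide_left minus_minus)
    then have "of_real (re z) + w * i = ((z + conjugate z) + (z - conjugate z)) / 2"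
      by (simp only: of_real_re add_divide_distrib)
    also have "(z + conjugate z) + (z - conjugate z) = 2 * z" by simp
    finally have "z = of_real (re z) + w * i" by simp
    then show ?thesis using w by metis
  qed
  with ii ci show ?thesis by blast
qed


text \<open>
  The inner product \<open>\<langle>x, y\<rangle> = y\<^sup>* x\<close> is \<open>x \<bullet>c y\<close>, conjugate-linear in the second argument.
  A relation in \<open>K\<^sup>n\<close> is a set of pairs; its domain and range are the library's \<open>Domain\<close> and
  \<open>Range\<close>, and the product \<open>\<D>\<L>\<close> (first \<open>\<L>\<close>, then \<open>\<D>\<close>) is \<open>\<L> O \<D>\<close>.
\<close>

definition linear_relation :: "nat \<Rightarrow> ('a :: real_or_complex vec \<times> 'a vec) set \<Rightarrow> bool" where
  "linear_relation n M \<longleftrightarrow>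
     M \<subseteq> carrier_vec n \<times> carrier_vec n \<and>
     (0\<^sub>v n, 0\<^sub>v n) \<in> M \<and>
     (\<forall>(x, y) \<in> M. \<forall>(x', y') \<in> M. (x + x', y + y') \<in> M) \<and>
     (\<forall>c. \<forall>(x, y) \<in> M. (c \<cdot>\<^sub>v x, c \<cdot>\<^sub>v y) \<in> M)"

definition rel_ker :: "nat \<Rightarrow> ('a :: real_or_complex vec \<times> 'a vec) set \<Rightarrow> 'a vec set" where
  "rel_ker n M = {x. (x, 0\<^sub>v n) \<in> M}"

definition rel_mul :: "nat \<Rightarrow> ('a :: real_or_complex vec \<times> 'a vec) set \<Rightarrow> 'a vec set" where
  "rel_mul n M = {y. (0\<^sub>v n, y) \<in> M}"

definition rel_adjoint ::
  "nat \<Rightarrow> ('a :: real_or_complex vec \<times> 'a vec) set \<Rightarrow> ('a vec \<times> 'a vec) set" where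
  "rel_adjoint n M =
     {(x, y). x \<in> carrier_vec n \<and> y \<in> carrier_vec n \<and> (\<forall>(v, w) \<in> M. w \<bullet>c x = v \<bullet>c y)}"

definition symmetric_relation :: "nat \<Rightarrow> ('a :: real_or_complex vec \<times> 'a vec) set \<Rightarrow> bool" where
  "symmetric_relation n M \<longleftrightarrow> M \<subseteq> rel_adjoint n M"

definition dissipative_relation :: "('a :: real_or_complex vec \<times> 'a vec) set \<Rightarrow> bool" where
  "dissipative_relation M \<longleftrightarrow> (\<forall>(x, y) \<in> M. re (x \<bullet>c y) \<le> 0)"

definition orth_compl :: "nat \<Rightarrow> 'a :: real_or_complex vec set \<Rightarrow> 'a vec set" where
  "orth_compl n S = {x \<in> carrier_vec n. \<forall>y \<in> S. x \<bullet>c y = 0}"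

definition subspace_sum :: "'a :: real_or_complex vec set \<Rightarrow> 'a vec set \<Rightarrow> 'a vec set" where
  "subspace_sum V W = {v + w | v w. v \<in> V \<and> w \<in> W}"

text \<open>The range of the stacked matrix \<open>[E; A]\<close>, under \<open>K\<^sup>2\<^sup>n \<cong> K\<^sup>n \<times> K\<^sup>n\<close>.\<close>

definition stacked_range ::
  "nat \<Rightarrow> 'a :: real_or_complex mat \<Rightarrow> 'a mat \<Rightarrow> ('a vec \<times> 'a vec) set" where
  "stacked_range n E A = {(E *\<^sub>v v, A *\<^sub>v v) | v. v \<in> carrier_vec n}"


definition unitary_mat :: "'a :: real_or_complex mat \<Rightarrow> bool" where
  "unitary_mat U \<longleftrightarrow>
     square_mat U \<and> inverts_mat U (mat_adjoint U) \<and> inverts_mat (mat_adjoint U) U"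

definition neg_semidef_mat :: "'a :: real_or_complex mat \<Rightarrow> bool" where
  "neg_semidef_mat M \<longleftrightarrow>
     square_mat M \<and> mat_adjoint M = M \<and>
     (\<forall>x \<in> carrier_vec (dim_col M). re ((M *\<^sub>v x) \<bullet>c x) \<le> 0)"

abbreviation const_poly_mat :: "'a :: real_or_complex mat \<Rightarrow> 'a poly mat" where
  "const_poly_mat \<equiv> map_mat (\<lambda>a. [:a:])"

text \<open>The pencil \<open>s E - A\<close>; the indeterminate \<open>s\<close> is \<open>[:0, 1:]\<close>.\<close>

definition pencil :: "'a :: real_or_complex mat \<Rightarrow> 'a mat \<Rightarrow> 'a poly mat" where
  "pencil E A = [:0, 1:] \<cdot>\<^sub>m const_poly_mat E - const_poly_mat A"

text \<open>Only used for square pencils. The determinant of a \<open>0 \<times> 0\<close> matrix is \<open>1\<close>, so the empty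
  pencil is regular.\<close>

definition regular_pencil :: "'a :: real_or_complex mat \<Rightarrow> 'a mat \<Rightarrow> bool" where
  "regular_pencil E A \<longleftrightarrow> det (pencil E A) \<noteq> 0"

end

theory Submission
  imports Defs
begin

text \<open>
  Let \<open>Y = ran \<L> \<inter> dom \<D>\<close> be the space of all intermediate vectors \<open>y\<close> with
  \<open>(x, y) \<in> \<L>\<close>, \<open>(y, z) \<in> \<D>\<close>, and let \<open>U = [Q\<^sub>1 Q\<^sub>2]\<close> be unitary with
  \<open>ran Q\<^sub>1 = Y\<close>, \<open>ran Q\<^sub>2 = Y\<^sup>\<bottom>\<close>. Symmetry and dissipativity give
  \<open>ker \<L>, mul \<D> \<subseteq> Y\<^sup>\<bottom>\<close>. Choose \<open>S\<close>, \<open>B\<close> with \<open>(S a, Q\<^sub>1 a) \<in> \<L>\<close> and \<open>(Q\<^sub>1 a, B a) \<in> \<D>\<close>,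
  and let \<open>P\<close>, \<open>P'\<close> be the orthogonal projectors onto \<open>ker \<L>\<close> and \<open>mul \<D>\<close>. Since these spaces
  meet trivially, their orthogonal complements span everything, so \<open>P u\<close> and \<open>P' u\<close> can be
  prescribed independently; hence \<open>\<D>\<L>\<close> consists of all pairs
  \<open>(S a + P Q\<^sub>2 b, B a - P' Q\<^sub>2 b)\<close>. In the coordinates given by \<open>U\<close> this parametrization is the
  asserted block form, and two parametrizations of the same space by \<open>n\<close> columns differ by an
  invertible right factor \<open>T\<close>.

  The pencil \<open>s R + R'\<close> of two orthogonal projectors is regular iff their kernels meet trivially:
  at \<open>s = 1\<close> it is a sum of positive semidefinite matrices. For the \<open>(2,2)\<close> block this says that
  \<open>ker \<L> + mul \<D>\<close> is all of \<open>Y\<^sup>\<bottom> = (ran \<L>)\<^sup>\<bottom> + (dom \<D>)\<^sup>\<bottom>\<close>.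
\<close>

section \<open>Adjoints and block matrices\<close>

lemma adjoint_carrier [simp, intro]:
  "A \<in> carrier_mat m n \<Longrightarrow> mat_adjoint A \<in> carrier_mat n m"
  unfolding mat_adjoint_def by auto

lemma adjoint_index [simp]:
  "i < dim_col A \<Longrightarrow> j < dim_row A \<Longrightarrow> mat_adjoint A $$ (i, j) = conjugate (A $$ (j, i))"
  unfolding mat_adjoint_def by (simp add: mat_of_rows_index)

lemma adjoint_dim [simp]:
  "dim_row (mat_adjoint A) = dim_col A" "dim_col (mat_adjoint A) = dim_row A"
  unfolding mat_adjoint_def by auto

lemma adjoint_adjoint [simp]: "mat_adjoint (mat_adjoint A) = A"
  by (rule eq_matI) auto

lemma cscalar_commute:
  fixes x y :: "'a :: conjugatable_field vec"
  assumes "x \<in> carrier_vec n" "y \<in> carrier_vec n"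
  shows "conjugate (x \<bullet>c y) = y \<bullet>c x"
  using assms
  by (auto simp: scalar_prod_def sum_conjugate conjugate_dist_mul mult.commute intro!: sum.cong)

lemma adjoint_mult:
  fixes A B :: "'a :: conjugatable_field mat"
  assumes "A \<in> carrier_mat m n" "B \<in> carrier_mat n k"
  shows "mat_adjoint (A * B) = mat_adjoint B * mat_adjoint A"
  using assms
  by (intro eq_matI)
    (auto simp: scalar_prod_def sum_conjugate conjugate_dist_mul mult.commute intro!: sum.cong)

lemma adjoint_one [simp]: "mat_adjoint (1\<^sub>m n) = (1\<^sub>m n :: 'a :: real_or_complex mat)"
proof -
  \<comment> \<open>Conjugating \<open>1 * conjugate 1\<close> factorwise, with
    \<open>conjugate\<close> an involution, gives \<open>1\<close> on one side and
    \<open>conjugate 1\<close> on the other.\<close>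
  have "conjugate (1 :: 'a) = 1"
    using conjugate_dist_mul[of "1 :: 'a" "conjugate 1"] by (simp add: mult.commute)
  then show ?thesis by (intro eq_matI) auto
qed

lemma adjoint_uminus:
  "mat_adjoint (- A) = - mat_adjoint (A :: 'a :: conjugatable_field mat)"
  by (intro eq_matI) (auto simp: conjugate_neg)

lemma adjoint_add:
  fixes A B :: "'a :: conjugatable_field mat"
  assumes "A \<in> carrier_mat m n" "B \<in> carrier_mat m n"
  shows "mat_adjoint (A + B) = mat_adjoint A + mat_adjoint B"
  using assms by (intro eq_matI) (auto simp: conjugate_dist_add)

text \<open>This is a Gram matrix. The column of \<open>B\<close> stands first because
  \<open>\<bullet>c\<close> conjugates its second argument.\<close>

lemma adjoint_mult_index:
  fixes A B :: "'a :: conjugatable_field mat"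
  assumes "A \<in> carrier_mat n k" "B \<in> carrier_mat n l" "i < k" "j < l"
  shows "(mat_adjoint A * B) $$ (i, j) = col B j \<bullet>c col A i"
  using assms by (auto simp: scalar_prod_def mult.commute intro!: sum.cong)

lemma cscalar_adjoint:
  fixes A :: "'a :: conjugatable_field mat"
  assumes "A \<in> carrier_mat m n" "x \<in> carrier_vec n" "y \<in> carrier_vec m"
  shows "(A *\<^sub>v x) \<bullet>c y = x \<bullet>c (mat_adjoint A *\<^sub>v y)"
proof -
  have "(A *\<^sub>v x) \<bullet>c y = (\<Sum>i<m. \<Sum>j<n. A $$ (i, j) * x $ j * conjugate (y $ i))"
    using assms by (auto simp: scalar_prod_def sum_distrib_right atLeast0LessThan intro!: sum.cong)
  also have "\<dots> = (\<Sum>j<n. \<Sum>i<m. A $$ (i, j) * x $ j * conjugate (y $ i))"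
    by (rule sum.swap)
  also have "\<dots> = x \<bullet>c (mat_adjoint A *\<^sub>v y)"
    using assms by (auto simp: scalar_prod_def sum_distrib_left sum_conjugate conjugate_dist_mul
        atLeast0LessThan ac_simps intro!: sum.cong)
  finally show ?thesis .
qed

lemma cscalar_adjoint':
  fixes A :: "'a :: conjugatable_field mat"
  assumes "A \<in> carrier_mat m n" "x \<in> carrier_vec m" "y \<in> carrier_vec n"
  shows "(mat_adjoint A *\<^sub>v x) \<bullet>c y = x \<bullet>c (A *\<^sub>v y)"
  using cscalar_adjoint[of "mat_adjoint A" n m x y] assms by simp

lemma mult_unit_vec_col:
  fixes A :: "'a :: semiring_1 mat"
  assumes "A \<in> carrier_mat m n" "j < n"
  shows "A *\<^sub>v unit_vec n j = col A j"
  using assms by (intro eq_vecI) auto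

lemma mat_eq_vecI:
  fixes A B :: "'a :: semiring_1 mat"
  assumes "A \<in> carrier_mat m n" "B \<in> carrier_mat m n"
    and "\<And>x. x \<in> carrier_vec n \<Longrightarrow> A *\<^sub>v x = B *\<^sub>v x"
  shows "A = B"
proof (rule mat_col_eqI)
  show "col A j = col B j" if "j < dim_col B" for j
    using assms(3)[of "unit_vec n j"] mult_unit_vec_col[OF assms(1), of j]
      mult_unit_vec_col[OF assms(2), of j] that assms(2) by simp
qed (use assms in auto)

lemma left_inverse_dim_le:
  fixes A B :: "'a :: field mat"
  assumes A: "A \<in> carrier_mat a b" and B: "B \<in> carrier_mat b a" and AB: "A * B = 1\<^sub>m a"
  shows "a \<le> b"
  \<comment> \<open>If \<open>b < a\<close>, pad both factors with zeros to \<open>a \<times> a\<close> matrices, which then commute.\<close>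
proof (rule ccontr)
  assume "\<not> a \<le> b"
  then have lt: "b < a" by simp
  define A' where "A' = mat a a (\<lambda>(i, j). if j < b then A $$ (i, j) else 0)"
  define B' where "B' = mat a a (\<lambda>(i, j). if i < b then B $$ (i, j) else 0)"
  have "A' * B' = A * B"
  proof (rule eq_matI)
    fix i j assume "i < dim_row (A * B)" "j < dim_col (A * B)"
    then have ij: "i < a" "j < a" using A B by auto
    have "(A' * B') $$ (i, j) = (\<Sum>k<a. A' $$ (i, k) * B' $$ (k, j))"
      using ij by (simp add: A'_def B'_def scalar_prod_def atLeast0LessThan)
    also have "\<dots> = (\<Sum>k<b. A' $$ (i, k) * B' $$ (k, j))"
      using lt ij by (intro sum.mono_neutral_right) (auto simp: A'_def)
    also have "\<dots> = (A * B) $$ (i, j)"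
      using lt ij A B by (simp add: A'_def B'_def scalar_prod_def atLeast0LessThan)
    finally show "(A' * B') $$ (i, j) = (A * B) $$ (i, j)" .
  qed (use A B in \<open>auto simp: A'_def B'_def\<close>)
  then have "A' * B' = 1\<^sub>m a" using AB by simp
  moreover have A': "A' \<in> carrier_mat a a" and B': "B' \<in> carrier_mat a a"
    by (simp_all add: A'_def B'_def)
  ultimately have "B' * A' = 1\<^sub>m a" using mat_mult_left_right_inverse by blast
  moreover have "(B' * A') $$ (b, b) = row B' b \<bullet> col A' b"
    using lt A' B' by simp
  moreover have "row B' b = 0\<^sub>v a"
    using lt by (intro eq_vecI) (simp_all add: B'_def)
  ultimately have "1\<^sub>m a $$ (b, b) = (0 :: 'a)"
    using lt A' by simp
  then show False using lt by simp
qed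

text \<open>The lower blocks have no rows, so that the product rules for
  \<open>four_block_mat\<close> apply to a single row of blocks.\<close>

definition hcat :: "'a :: zero mat \<Rightarrow> 'a mat \<Rightarrow> 'a mat" where
  "hcat A B = four_block_mat A B (0\<^sub>m 0 (dim_col A)) (0\<^sub>m 0 (dim_col B))"

lemma hcat_carrier [simp, intro]:
  "A \<in> carrier_mat n k \<Longrightarrow> B \<in> carrier_mat n l \<Longrightarrow> hcat A B \<in> carrier_mat n (k + l)"
  unfolding hcat_def by auto

lemma hcat_mult_vec:
  fixes A B :: "'a :: semiring_1 mat"
  assumes "A \<in> carrier_mat n k" "B \<in> carrier_mat n l" "x \<in> carrier_vec k" "y \<in> carrier_vec l"
  shows "hcat A B *\<^sub>v (x @\<^sub>v y) = A *\<^sub>v x + B *\<^sub>v y"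
proof -
  have "hcat A B *\<^sub>v (x @\<^sub>v y) =
      (A *\<^sub>v x + B *\<^sub>v y) @\<^sub>v (0\<^sub>m 0 k *\<^sub>v x + 0\<^sub>m 0 l *\<^sub>v y)"
    unfolding hcat_def using assms
    by (subst four_block_mat_mult_vec[of _ n k _ l _ 0]) auto
  also have "\<dots> = A *\<^sub>v x + B *\<^sub>v y"
    using assms by (intro eq_vecI) auto
  finally show ?thesis .
qed

text \<open>The Gram matrix is computed blockwise: the diagonal blocks are identities, and the two
  mixed blocks are adjoints of each other, so both vanish.\<close>

lemma hcat_orthonormal:
  fixes A B :: "'a :: real_or_complex mat"
  assumes "A \<in> carrier_mat n k" "B \<in> carrier_mat n l"
    and "mat_adjoint A * A = 1\<^sub>m k" "mat_adjoint B * B = 1\<^sub>m l" "mat_adjoint A * B = 0\<^sub>m k l"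
  shows "mat_adjoint (hcat A B) * hcat A B = 1\<^sub>m (k + l)"
proof -
  have adj: "mat_adjoint (hcat A B) =
      four_block_mat (mat_adjoint A) (0\<^sub>m k 0) (mat_adjoint B) (0\<^sub>m l 0)"
    using assms(1,2) by (intro eq_matI) (auto simp: hcat_def)
  have BA: "mat_adjoint B * A = 0\<^sub>m l k"
  proof -
    have "mat_adjoint B * A = mat_adjoint (mat_adjoint A * B)"
      using assms(1,2) by (subst adjoint_mult[of _ k n _ l]) auto
    also have "\<dots> = 0\<^sub>m l k" unfolding assms(5) by (intro eq_matI) auto
    finally show ?thesis .
  qed
  \<comment> \<open>Products over an empty inner index are zero; they stem from the rowless lower
    blocks of \<open>hcat\<close>.\<close>
  have z: "X + 0\<^sub>m a 0 * 0\<^sub>m 0 b = X" if "X \<in> carrier_mat a b" for a b and X :: "'a mat"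
    using that by (intro eq_matI) auto
  show ?thesis
    unfolding adj using assms BA unfolding hcat_def
    by (subst mult_four_block_mat[of _ k n _ 0 _ l _ _ k _ l]) (auto simp: z)
qed

section \<open>Orthogonal projectors and complements\<close>

definition mat_range :: "'a :: semiring_0 mat \<Rightarrow> 'a vec set" where
  "mat_range A = (\<lambda>x. A *\<^sub>v x) ` carrier_vec (dim_col A)"

lemma mat_range_eq: "A \<in> carrier_mat m n \<Longrightarrow> mat_range A = (\<lambda>x. A *\<^sub>v x) ` carrier_vec n"
  unfolding mat_range_def by auto

definition vec_subspace :: "nat \<Rightarrow> 'a :: field vec set \<Rightarrow> bool" where
  "vec_subspace n W \<longleftrightarrow> W \<subseteq> carrier_vec n \<and> 0\<^sub>v n \<in> W \<and>
     (\<forall>x \<in> W. \<forall>y \<in> W. x + y \<in> W) \<and> (\<forall>c. \<forall>x \<in> W. c \<cdot>\<^sub>v x \<in> W)"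

lemma vec_subspace_diff:
  assumes "vec_subspace n W" "x \<in> W" "y \<in> W"
  shows "x - y \<in> W"
proof -
  have "x - y = x + (-1) \<cdot>\<^sub>v y"
    using assms by (intro eq_vecI) (auto simp: vec_subspace_def)
  then show ?thesis using assms by (simp add: vec_subspace_def)
qed

section \<open>Orthonormal bases of subspaces\<close>

lemma cscalar_self: "x \<bullet>c x = of_real (\<Sum>i<dim_vec x. (norm (x $ i))\<^sup>2)"
  for x :: "'a :: real_or_complex vec"
  by (simp add: scalar_prod_def atLeast0LessThan mult_conjugate_norm)

text \<open>The scalar \<open>c\<close> is the inverse of the Euclidean length of \<open>v\<close>.
  The unit vector is kept as a one-column matrix, ready to be appended by
  \<open>hcat\<close>.\<close>

lemma normalized_column:
  fixes v :: "'a :: real_or_complex vec"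
  assumes v: "v \<in> carrier_vec n" "v \<noteq> 0\<^sub>v n"
  obtains B c where "B \<in> carrier_mat n 1" "mat_adjoint B * B = 1\<^sub>m 1"
    "\<And>x. x \<in> carrier_vec 1 \<Longrightarrow> B *\<^sub>v x = (c * x $ 0) \<cdot>\<^sub>v v"
proof -
  define r where "r = (\<Sum>i<n. (norm (v $ i))\<^sup>2)"
  have vv: "v \<bullet>c v = of_real r" using v cscalar_self[of v] by (simp add: r_def)
  moreover have "v \<bullet>c v \<noteq> 0" using v by simp
  ultimately have "r \<noteq> 0" by auto
  moreover have "r \<ge> 0" unfolding r_def by (intro sum_nonneg) auto
  ultimately have r: "r > 0" by simp
  define c where "c = (of_real (1 / sqrt r) :: 'a)"
  have "c * conjugate c = of_real ((norm c)\<^sup>2)" by (rule mult_conjugate_norm)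
  also have "(norm c)\<^sup>2 = 1 / r" using r by (simp add: c_def norm_divide power_divide)
  finally have cc: "c * conjugate c * of_real r = 1" using r by simp
  define B where "B = mat n 1 (\<lambda>(i, j). c * v $ i)"
  have B: "B \<in> carrier_mat n 1" by (simp add: B_def)
  have col: "col B 0 = c \<cdot>\<^sub>v v" using v by (intro eq_vecI) (auto simp: B_def)
  have "col B 0 \<bullet>c col B 0 = (c * conjugate c) * (v \<bullet>c v)"
    unfolding col using v by (simp add: conjugate_smult_vec)
  then have "col B 0 \<bullet>c col B 0 = 1" using cc vv by simp
  then have "(mat_adjoint B * B) $$ (0, 0) = 1"
    using adjoint_mult_index[OF B B, of 0 0] by simp
  then have "mat_adjoint B * B = 1\<^sub>m 1" using B by (intro eq_matI) auto
  moreover have "B *\<^sub>v x = (c * x $ 0) \<cdot>\<^sub>v v" if "x \<in> carrier_vec 1" for x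
    using that v by (intro eq_vecI) (auto simp: B_def scalar_prod_def)
  ultimately show thesis using that B by blast
qed

text \<open>An orthonormal family inside \<open>W\<close> of the largest possible size spans
  \<open>W\<close>: otherwise the normalized Gram-Schmidt residual of a missing vector could be
  appended.\<close>

lemma orthonormal_basis:
  fixes W :: "'a :: real_or_complex vec set"
  assumes W: "vec_subspace n W"
  obtains k Q where "Q \<in> carrier_mat n k" "mat_adjoint Q * Q = 1\<^sub>m k" "mat_range Q = W"
proof -
  define good where "good k \<longleftrightarrow>
    (\<exists>Q \<in> carrier_mat n k. mat_adjoint Q * Q = (1\<^sub>m k :: 'a mat) \<and> mat_range Q \<subseteq> W)" for k
  have "0\<^sub>m n 0 *\<^sub>v x = 0\<^sub>v n" if "x \<in> carrier_vec 0" for x :: "'a vec"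
    using that by (intro eq_vecI) (auto simp: scalar_prod_def)
  then have "mat_range (0\<^sub>m n 0 :: 'a mat) \<subseteq> W"
    using W by (auto simp: mat_range_def vec_subspace_def)
  moreover have "mat_adjoint (0\<^sub>m n 0) * 0\<^sub>m n 0 = (1\<^sub>m 0 :: 'a mat)" by (intro eq_matI) auto
  ultimately have good0: "good 0"
    unfolding good_def by (intro bexI[of _ "0\<^sub>m n 0"]) auto
  \<comment> \<open>The matrix \<open>mat_adjoint Q\<close> is a left inverse of \<open>Q\<close>
    with \<open>k\<close> rows and \<open>n\<close> columns; this bound makes the maximum
    exist.\<close>
  have bound: "k \<le> n" if "good k" for k
    using that left_inverse_dim_le unfolding good_def by (metis adjoint_carrier)
  define k where "k = (GREATEST k. good k)"
  have "good k" unfolding k_def using good0 bound by (rule GreatestI_nat)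
  then obtain Q where Q: "Q \<in> carrier_mat n k" "mat_adjoint Q * Q = 1\<^sub>m k" "mat_range Q \<subseteq> W"
    unfolding good_def by blast
  have "x \<in> mat_range Q" if x: "x \<in> W" for x
  proof (rule ccontr)
    assume nx: "x \<notin> mat_range Q"
    have xc: "x \<in> carrier_vec n" using x W by (auto simp: vec_subspace_def)
    define y where "y = mat_adjoint Q *\<^sub>v x"
    have y: "y \<in> carrier_vec k"
      unfolding y_def using Q(1) xc by (intro mult_mat_vec_carrier) auto
    \<comment> \<open>Gram-Schmidt residual: \<open>Q *\<^sub>v y\<close> is the projection of
      \<open>x\<close> onto the span of the columns already found.\<close>
    define v where "v = x - Q *\<^sub>v y"
    have Qy: "Q *\<^sub>v y \<in> mat_range Q" using y Q(1) by (auto simp: mat_range_eq[OF Q(1)])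
    have v: "v \<in> carrier_vec n" unfolding v_def using Q(1) xc y by simp
    have vW: "v \<in> W" unfolding v_def using W x Qy Q(3) by (intro vec_subspace_diff) auto
    have "v \<noteq> 0\<^sub>v n"
    proof
      assume "v = 0\<^sub>v n"
      then have "v + Q *\<^sub>v y = 0\<^sub>v n + Q *\<^sub>v y" by simp
      moreover have "v + Q *\<^sub>v y = x" unfolding v_def using Q(1) xc y by (intro eq_vecI) auto
      ultimately have "x = Q *\<^sub>v y" using Q(1) y by simp
      then show False using Qy nx by simp
    qed
    with v obtain B c where B: "B \<in> carrier_mat n 1" "mat_adjoint B * B = 1\<^sub>m 1"
      and Bx: "\<And>x. x \<in> carrier_vec 1 \<Longrightarrow> B *\<^sub>v x = (c * x $ 0) \<cdot>\<^sub>v v"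
      using normalized_column by blast
    have Qv: "mat_adjoint Q *\<^sub>v v = 0\<^sub>v k"
    proof -
      have "mat_adjoint Q *\<^sub>v (Q *\<^sub>v y) = (mat_adjoint Q * Q) *\<^sub>v y"
        using Q(1) y by (intro assoc_mult_mat_vec[symmetric]) auto
      also have "\<dots> = y" using Q(2) y by simp
      finally have "mat_adjoint Q *\<^sub>v v = y - y"
        unfolding v_def y_def[symmetric] using Q(1) xc y
        by (subst mult_minus_distrib_mat_vec[of _ k n]) (auto simp: y_def)
      then show ?thesis using y by simp
    qed
    have "mat_adjoint Q * B = 0\<^sub>m k 1"
    proof (rule mat_eq_vecI)
      fix z :: "'a vec" assume z: "z \<in> carrier_vec 1"
      have "(mat_adjoint Q * B) *\<^sub>v z = mat_adjoint Q *\<^sub>v ((c * z $ 0) \<cdot>\<^sub>v v)"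
        using Bx[OF z] Q(1) B(1) z by (subst assoc_mult_mat_vec[of _ k n _ 1]) auto
      also have "\<dots> = (c * z $ 0) \<cdot>\<^sub>v 0\<^sub>v k"
        using Qv v Q(1) by (subst mult_mat_vec[of _ k n]) auto
      finally show "(mat_adjoint Q * B) *\<^sub>v z = 0\<^sub>m k 1 *\<^sub>v z" using z by auto
    qed (use Q(1) B(1) in \<open>auto intro: mult_carrier_mat\<close>)
    then have "mat_adjoint (hcat Q B) * hcat Q B = 1\<^sub>m (k + 1)"
      using Q B by (intro hcat_orthonormal) auto
    moreover have "mat_range (hcat Q B) \<subseteq> W"
    proof
      fix w assume "w \<in> mat_range (hcat Q B)"
      then obtain z where z: "z \<in> carrier_vec (k + 1)" "w = hcat Q B *\<^sub>v z"
        using mat_range_eq[OF hcat_carrier[OF Q(1) B(1)]] by auto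
      define p q where "p = vec_first z k" and "q = vec_last z 1"
      have pq: "p \<in> carrier_vec k" "q \<in> carrier_vec 1" "z = p @\<^sub>v q"
        using z by (auto simp: p_def q_def)
      have "w = Q *\<^sub>v p + (c * q $ 0) \<cdot>\<^sub>v v"
        unfolding z(2) pq(3) using Bx pq(1,2) Q(1) B(1) by (subst hcat_mult_vec) auto
      moreover have "Q *\<^sub>v p \<in> W" using Q(1,3) pq(1) by (auto simp: mat_range_eq[OF Q(1)])
      ultimately show "w \<in> W" using W vW by (auto simp: vec_subspace_def)
    qed
    ultimately have "good (k + 1)"
      unfolding good_def using hcat_carrier[OF Q(1) B(1)] by blast
    then have "k + 1 \<le> k" unfolding k_def using bound by (rule Greatest_le_nat)
    then show False by simp
  qed
  then show thesis using that Q by blast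
qed

section \<open>Projectors and duality of complements\<close>

lemma vec_diff_add_cancel:
  fixes x y :: "'a :: ab_group_add vec"
  assumes "x \<in> carrier_vec n" "y \<in> carrier_vec n"
  shows "x - y + y = x"
  using assms by (intro eq_vecI) auto

lemma vec_subspace_carrier: "vec_subspace n W \<Longrightarrow> W \<subseteq> carrier_vec n"
  by (simp add: vec_subspace_def)

lemma vec_subspace_orth_compl:
  assumes "S \<subseteq> carrier_vec n"
  shows "vec_subspace n (orth_compl n S)"
  using assms
  by (auto simp: vec_subspace_def orth_compl_def add_scalar_prod_distrib[of _ n] subset_iff)

text \<open>Conjugate symmetry; \<open>orth_compl\<close> itself has the vector of the complement in
  the first slot.\<close>

lemma orth_compl_commute:
  assumes "S \<subseteq> carrier_vec n" "x \<in> orth_compl n S" "y \<in> S"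
  shows "y \<bullet>c x = 0"
  using assms cscalar_commute[of x n y] by (auto simp: orth_compl_def subset_iff)

text \<open>Being Hermitian, mapping into \<open>W\<close> and fixing \<open>W\<close> pointwise
  characterizes the orthogonal projector onto \<open>W\<close>; idempotency and orthogonality of the
  residual are derived below.\<close>

definition orth_projector :: "nat \<Rightarrow> 'a :: real_or_complex vec set \<Rightarrow> 'a mat \<Rightarrow> bool" where
  "orth_projector n W P \<longleftrightarrow> P \<in> carrier_mat n n \<and> mat_adjoint P = P \<and>
     (\<forall>x \<in> carrier_vec n. P *\<^sub>v x \<in> W) \<and> (\<forall>x \<in> W. P *\<^sub>v x = x)"

text \<open>Orthonormality lets \<open>mat_adjoint Q\<close> recover the coordinates of a vector in
  the range of \<open>Q\<close>, so the range is fixed pointwise.\<close>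

lemma orth_projector_of_basis:
  fixes Q :: "'a :: real_or_complex mat"
  assumes Q: "Q \<in> carrier_mat n k" "mat_adjoint Q * Q = 1\<^sub>m k"
  shows "orth_projector n (mat_range Q) (Q * mat_adjoint Q)"
proof -
  have Q': "mat_adjoint Q \<in> carrier_mat k n" using Q by simp
  have "Q * mat_adjoint Q \<in> carrier_mat n n" using Q(1) Q' by simp
  moreover have "mat_adjoint (Q * mat_adjoint Q) = Q * mat_adjoint Q"
    using adjoint_mult[OF Q(1) Q'] by simp
  moreover have "(Q * mat_adjoint Q) *\<^sub>v x \<in> mat_range Q" if "x \<in> carrier_vec n" for x
  proof -
    have "mat_adjoint Q *\<^sub>v x \<in> carrier_vec k" using Q' that by simp
    then show ?thesis
      unfolding mat_range_eq[OF Q(1)] assoc_mult_mat_vec[OF Q(1) Q' that] by blast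
  qed
  moreover have "(Q * mat_adjoint Q) *\<^sub>v x = x" if "x \<in> mat_range Q" for x
  proof -
    from that obtain y where y: "y \<in> carrier_vec k" "x = Q *\<^sub>v y"
      unfolding mat_range_eq[OF Q(1)] by blast
    have x: "x \<in> carrier_vec n" using Q(1) y by simp
    have "mat_adjoint Q *\<^sub>v x = y"
      unfolding y(2) assoc_mult_mat_vec[OF Q' Q(1) y(1), symmetric] Q(2) using y(1) by simp
    then show ?thesis using assoc_mult_mat_vec[OF Q(1) Q' x] y(2) by metis
  qed
  ultimately show ?thesis unfolding orth_projector_def by blast
qed

lemma orth_projector_exists:
  fixes W :: "'a :: real_or_complex vec set"
  assumes "vec_subspace n W"
  obtains P where "orth_projector n W P"
  using orthonormal_basis[OF assms] orth_projector_of_basis by metis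

lemma orth_projector_idem:
  assumes "orth_projector n W P"
  shows "P * P = P"
proof (rule mat_eq_vecI)
  show "P * P \<in> carrier_mat n n" "P \<in> carrier_mat n n"
    using assms by (auto simp: orth_projector_def)
  fix x :: "'a vec" assume x: "x \<in> carrier_vec n"
  show "(P * P) *\<^sub>v x = P *\<^sub>v x"
    using assms x by (subst assoc_mult_mat_vec[of _ n n _ n]) (auto simp: orth_projector_def)
qed

text \<open>For \<open>w\<close> in \<open>W\<close>, self-adjointness moves \<open>P\<close> onto
  \<open>w\<close>, where it acts as the identity; hence \<open>x\<close> and its projection have
  the same inner product with \<open>w\<close>.\<close>

lemma orth_projector_residual:
  assumes P: "orth_projector n W P" and W: "W \<subseteq> carrier_vec n" and x: "x \<in> carrier_vec n"
  shows "x - P *\<^sub>v x \<in> orth_compl n W"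
proof -
  have Pc: "P \<in> carrier_mat n n" and adj: "mat_adjoint P = P"
    using P by (auto simp: orth_projector_def)
  have "(x - P *\<^sub>v x) \<bullet>c w = 0" if w: "w \<in> W" for w
  proof -
    have wc: "w \<in> carrier_vec n" using w W by auto
    have "x \<bullet>c w = x \<bullet>c (P *\<^sub>v w)" using P w by (simp add: orth_projector_def)
    also have "\<dots> = (P *\<^sub>v x) \<bullet>c w" using cscalar_adjoint[OF Pc x wc] adj by simp
    finally show ?thesis
      using Pc x wc by (simp add: minus_scalar_prod_distrib[of _ n])
  qed
  then show ?thesis using Pc x by (auto simp: orth_compl_def)
qed

text \<open>If the projection is zero, \<open>x\<close> is its own residual. If \<open>x\<close> is
  orthogonal to \<open>W\<close>, the squared norm of the projection equals the inner product of
  \<open>x\<close> with a vector of \<open>W\<close>, hence zero.\<close>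

lemma orth_projector_eq_0_iff:
  assumes P: "orth_projector n W P" and W: "W \<subseteq> carrier_vec n" and x: "x \<in> carrier_vec n"
  shows "P *\<^sub>v x = 0\<^sub>v n \<longleftrightarrow> x \<in> orth_compl n W"
proof
  have Pc: "P \<in> carrier_mat n n" and adj: "mat_adjoint P = P"
    using P by (auto simp: orth_projector_def)
  show "x \<in> orth_compl n W" if "P *\<^sub>v x = 0\<^sub>v n"
    using orth_projector_residual[OF assms] that x by simp
  show "P *\<^sub>v x = 0\<^sub>v n" if xo: "x \<in> orth_compl n W"
  proof -
    have Px: "P *\<^sub>v x \<in> W" "P *\<^sub>v x \<in> carrier_vec n"
      using P x Pc by (auto simp: orth_projector_def)
    have "(P *\<^sub>v x) \<bullet>c (P *\<^sub>v x) = x \<bullet>c (P *\<^sub>v (P *\<^sub>v x))"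
      using cscalar_adjoint[OF Pc x Px(2)] adj by simp
    also have "P *\<^sub>v (P *\<^sub>v x) = P *\<^sub>v x" using P Px by (simp add: orth_projector_def)
    also have "x \<bullet>c (P *\<^sub>v x) = 0" using xo Px by (simp add: orth_compl_def)
    finally show ?thesis using Px(2) by simp
  qed
qed

text \<open>For \<open>x\<close> in the double complement, the residual \<open>r\<close> is
  orthogonal both to \<open>x\<close> and to the projection of \<open>x\<close>, hence to
  itself.\<close>

lemma double_orth_compl:
  assumes W: "vec_subspace n W"
  shows "orth_compl n (orth_compl n W) = W"
proof
  note Wc = vec_subspace_carrier[OF W]
  show "W \<subseteq> orth_compl n (orth_compl n W)"
    using Wc orth_compl_commute[OF Wc] by (auto simp: orth_compl_def[of n "orth_compl n W"])
  obtain P where P: "orth_projector n W P" using orth_projector_exists[OF W] .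
  show "orth_compl n (orth_compl n W) \<subseteq> W"
  proof
    fix x assume x: "x \<in> orth_compl n (orth_compl n W)"
    then have xc: "x \<in> carrier_vec n" by (simp add: orth_compl_def)
    define r where "r = x - P *\<^sub>v x"
    have r: "r \<in> orth_compl n W" unfolding r_def by (rule orth_projector_residual[OF P Wc xc])
    have Px: "P *\<^sub>v x \<in> W" using P xc by (simp add: orth_projector_def)
    have c: "r \<in> carrier_vec n" "P *\<^sub>v x \<in> carrier_vec n" 
      using r Px Wc by (auto simp: orth_compl_def)
    have "r \<bullet>c r = x \<bullet>c r - (P *\<^sub>v x) \<bullet>c r"
      using xc c by (subst (1) r_def) (simp add: minus_scalar_prod_distrib[of _ n])
    also have "\<dots> = 0"
      using x r orth_compl_commute[OF Wc r Px] by (simp add: orth_compl_def[of n "orth_compl n W"])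
    finally have "r = 0\<^sub>v n" using c by simp
    moreover have "r + P *\<^sub>v x = x" unfolding r_def by (rule vec_diff_add_cancel[OF xc c(2)])
    ultimately have "P *\<^sub>v x = x" using c by simp
    then show "x \<in> W" using Px by metis
  qed
qed

lemma vec_subspace_sum:
  assumes V: "vec_subspace n V" and W: "vec_subspace n W"
  shows "vec_subspace n (subspace_sum V W)"
proof -
  note c = V[unfolded vec_subspace_def] W[unfolded vec_subspace_def]
  have "subspace_sum V W \<subseteq> carrier_vec n" using c by (auto simp: subspace_sum_def subset_iff)
  moreover have "0\<^sub>v n \<in> subspace_sum V W"
    using c unfolding subspace_sum_def by (auto intro!: exI[of _ "0\<^sub>v n"])
  moreover have "x + y \<in> subspace_sum V W" if xy: "x \<in> subspace_sum V W" "y \<in> subspace_sum V W" for x y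
  proof -
    obtain a b a' b' where ab: "x = a + b" "y = a' + b'" "a \<in> V" "b \<in> W" "a' \<in> V" "b' \<in> W"
      using xy by (auto simp: subspace_sum_def)
    then have "a \<in> carrier_vec n" "b \<in> carrier_vec n" "a' \<in> carrier_vec n" "b' \<in> carrier_vec n"
      using c by blast+
    then have "x + y = (a + a') + (b + b')"
      unfolding ab(1,2) by (intro eq_vecI) auto
    moreover have "a + a' \<in> V" "b + b' \<in> W" using c ab by auto
    ultimately show ?thesis unfolding subspace_sum_def by blast
  qed
  moreover have "k \<cdot>\<^sub>v x \<in> subspace_sum V W" if x: "x \<in> subspace_sum V W" for k x
  proof -
    obtain a b where ab: "x = a + b" "a \<in> V" "b \<in> W" using x by (auto simp: subspace_sum_def)
    then have "a \<in> carrier_vec n" "b \<in> carrier_vec n" using c by blast+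
    then have "k \<cdot>\<^sub>v x = k \<cdot>\<^sub>v a + k \<cdot>\<^sub>v b"
      unfolding ab(1) by (rule smult_add_distrib_vec)
    moreover have "k \<cdot>\<^sub>v a \<in> V" "k \<cdot>\<^sub>v b \<in> W" using c ab by auto
    ultimately show ?thesis unfolding subspace_sum_def by blast
  qed
  ultimately show ?thesis by (auto simp: vec_subspace_def)
qed

lemma subset_subspace_sum:
  assumes V: "vec_subspace n V" and W: "vec_subspace n W"
  shows "V \<subseteq> subspace_sum V W" "W \<subseteq> subspace_sum V W"
proof -
  note c = V[unfolded vec_subspace_def] W[unfolded vec_subspace_def]
  show "V \<subseteq> subspace_sum V W"
  proof
    fix v assume v: "v \<in> V"
    then have "v = v + 0\<^sub>v n" using c by auto
    then show "v \<in> subspace_sum V W" using c v unfolding subspace_sum_def by blast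
  qed
  show "W \<subseteq> subspace_sum V W"
  proof
    fix v assume v: "v \<in> W"
    then have "v = 0\<^sub>v n + v" using c by auto
    then show "v \<in> subspace_sum V W" using c v unfolding subspace_sum_def by blast
  qed
qed

lemma orth_compl_antimono: "S \<subseteq> S' \<Longrightarrow> orth_compl n S' \<subseteq> orth_compl n S"
  by (auto simp: orth_compl_def)

text \<open>The inclusion from left to right is dual: the complement of the sum lies in both double
  complements, that is in \<open>V \<inter> W\<close>, and complements are taken once more.\<close>

lemma orth_compl_Int:
  assumes V: "vec_subspace n V" and W: "vec_subspace n W"
  shows "orth_compl n (V \<inter> W) = subspace_sum (orth_compl n V) (orth_compl n W)" (is "_ = ?Z")
proof
  note V' = vec_subspace_orth_compl[OF vec_subspace_carrier[OF V]]
  note W' = vec_subspace_orth_compl[OF vec_subspace_carrier[OF W]]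
  have Z: "vec_subspace n ?Z" by (rule vec_subspace_sum[OF V' W'])
  show "?Z \<subseteq> orth_compl n (V \<inter> W)"
    using vec_subspace_carrier[OF V]
    by (auto simp: subspace_sum_def orth_compl_def add_scalar_prod_distrib[of _ n] subset_iff)
  have "orth_compl n ?Z \<subseteq> V \<inter> W"
    using orth_compl_antimono[OF subset_subspace_sum(1)[OF V' W'], of n]
      orth_compl_antimono[OF subset_subspace_sum(2)[OF V' W'], of n]
    unfolding double_orth_compl[OF V] double_orth_compl[OF W] by blast
  then have "orth_compl n (V \<inter> W) \<subseteq> orth_compl n (orth_compl n ?Z)"
    by (rule orth_compl_antimono)
  then show "orth_compl n (V \<inter> W) \<subseteq> ?Z" unfolding double_orth_compl[OF Z] .
qed

text \<open>Trivial intersection means that the two complements span everything. Splitting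
  \<open>v - w = a + b\<close> accordingly gives the single vector \<open>u = v - a = w + b\<close>,
  in which \<open>P\<close> annihilates \<open>a\<close> and \<open>Q\<close> annihilates
  \<open>b\<close>.\<close>

lemma simultaneous_projection:
  assumes V: "vec_subspace n V" and W: "vec_subspace n W" and VW: "V \<inter> W = {0\<^sub>v n}"
    and P: "orth_projector n V P" and Q: "orth_projector n W Q"
    and v: "v \<in> V" and w: "w \<in> W"
  obtains u where "u \<in> carrier_vec n" "P *\<^sub>v u = v" "Q *\<^sub>v u = w"
proof -
  note Vc = vec_subspace_carrier[OF V] and Wc = vec_subspace_carrier[OF W]
  have vw: "v \<in> carrier_vec n" "w \<in> carrier_vec n" using v w Vc Wc by auto
  \<comment> \<open>The complement of the zero space is the whole space.\<close>
  then have "v - w \<in> orth_compl n (V \<inter> W)"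
    unfolding VW by (auto simp: orth_compl_def minus_scalar_prod_distrib[of _ n])
  then obtain a b where ab: "v - w = a + b" "a \<in> orth_compl n V" "b \<in> orth_compl n W"
    unfolding orth_compl_Int[OF V W] subspace_sum_def by blast
  then have abc: "a \<in> carrier_vec n" "b \<in> carrier_vec n" by (auto simp: orth_compl_def)
  have eq: "v - a = w + b"
  proof (rule eq_vecI)
    fix i assume i: "i < dim_vec (w + b)"
    then have "(v - w) $ i = (a + b) $ i" using ab by simp
    then show "(v - a) $ i = (w + b) $ i" using i vw abc by (simp add: algebra_simps)
  qed (use vw abc in auto)
  have Pc: "P \<in> carrier_mat n n" "Q \<in> carrier_mat n n" using P Q by (auto simp: orth_projector_def)
  have "P *\<^sub>v a = 0\<^sub>v n" "Q *\<^sub>v b = 0\<^sub>v n"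
    using orth_projector_eq_0_iff[OF P Vc] orth_projector_eq_0_iff[OF Q Wc] ab abc by auto
  moreover have "P *\<^sub>v v = v" "Q *\<^sub>v w = w" using P Q v w by (auto simp: orth_projector_def)
  ultimately have "P *\<^sub>v (v - a) = v" "Q *\<^sub>v (w + b) = w"
    using Pc vw abc by (simp_all add: mult_minus_distrib_mat_vec[of _ n n] mult_add_distrib_mat_vec[of _ n n])
  then show thesis using that[of "v - a"] vw abc eq by auto
qed

section \<open>Splitting the space along a subspace\<close>

lemma hcat_mult_adjoint:
  fixes A B :: "'a :: real_or_complex mat"
  assumes "A \<in> carrier_mat n k" "B \<in> carrier_mat n l"
  shows "hcat A B * mat_adjoint (hcat A B) = A * mat_adjoint A + B * mat_adjoint B"
proof (rule eq_matI)
  have adj: "mat_adjoint (hcat A B) =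
      four_block_mat (mat_adjoint A) (0\<^sub>m k 0) (mat_adjoint B) (0\<^sub>m l 0)"
    using assms(1,2) by (intro eq_matI) (auto simp: hcat_def)
  have A: "mat_adjoint A \<in> carrier_mat k n" "mat_adjoint B \<in> carrier_mat l n" using assms by auto
  have "hcat A B * mat_adjoint (hcat A B) =
    four_block_mat (A * mat_adjoint A + B * mat_adjoint B)
      (A * 0\<^sub>m k 0 + B * 0\<^sub>m l 0)
      (0\<^sub>m 0 k * mat_adjoint A + 0\<^sub>m 0 l * mat_adjoint B) (0\<^sub>m 0 k * 0\<^sub>m k 0 + 0\<^sub>m 0 l * 0\<^sub>m l 0)"
    unfolding adj using assms A unfolding hcat_def
    by (subst mult_four_block_mat[of _ n k _ l _ 0 _ _ n _ 0]) auto
  then show "(hcat A B * mat_adjoint (hcat A B)) $$ (i, j) =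
      (A * mat_adjoint A + B * mat_adjoint B) $$ (i, j)"
    if "i < dim_row (A * mat_adjoint A + B * mat_adjoint B)"
      "j < dim_col (A * mat_adjoint A + B * mat_adjoint B)" for i j
    using that assms by simp
qed (use assms in \<open>auto simp: hcat_def\<close>)

text \<open>Orthonormal bases of \<open>W\<close> and of its complement are joined. Their projectors
  add up to the identity, which makes the joined matrix unitary.\<close>

lemma orthogonal_decomposition:
  fixes W :: "'a :: real_or_complex vec set"
  assumes W: "vec_subspace n W"
  obtains k l Q\<^sub>1 Q\<^sub>2 where "Q\<^sub>1 \<in> carrier_mat n k" "Q\<^sub>2 \<in> carrier_mat n l" "k + l = n"
    "mat_adjoint Q\<^sub>1 * Q\<^sub>1 = 1\<^sub>m k" "mat_adjoint Q\<^sub>2 * Q\<^sub>2 = 1\<^sub>m l" "mat_adjoint Q\<^sub>1 * Q\<^sub>2 = 0\<^sub>m k l"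
    "mat_adjoint Q\<^sub>2 * Q\<^sub>1 = 0\<^sub>m l k"
    "Q\<^sub>1 * mat_adjoint Q\<^sub>1 + Q\<^sub>2 * mat_adjoint Q\<^sub>2 = 1\<^sub>m n"
    "mat_range Q\<^sub>1 = W" "mat_range Q\<^sub>2 = orth_compl n W"
proof -
  note Wc = vec_subspace_carrier[OF W]
  note W' = vec_subspace_orth_compl[OF Wc]
  note Wc' = vec_subspace_carrier[OF W']
  obtain k Q\<^sub>1 where Q1: "Q\<^sub>1 \<in> carrier_mat n k" "mat_adjoint Q\<^sub>1 * Q\<^sub>1 = 1\<^sub>m k" "mat_range Q\<^sub>1 = W"
    using orthonormal_basis[OF W] .
  obtain l Q\<^sub>2 where Q2: "Q\<^sub>2 \<in> carrier_mat n l" "mat_adjoint Q\<^sub>2 * Q\<^sub>2 = 1\<^sub>m l"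
    "mat_range Q\<^sub>2 = orth_compl n W"
    using orthonormal_basis[OF W'] .
  have col1: "col Q\<^sub>1 i \<in> W" if "i < k" for i
    using that Q1 mult_unit_vec_col[OF Q1(1) that] mat_range_eq[OF Q1(1)]
    by (metis imageI unit_vec_carrier)
  have col2: "col Q\<^sub>2 i \<in> orth_compl n W" if "i < l" for i
    using that Q2 mult_unit_vec_col[OF Q2(1) that] mat_range_eq[OF Q2(1)]
    by (metis imageI unit_vec_carrier)
  have z12: "mat_adjoint Q\<^sub>1 * Q\<^sub>2 = 0\<^sub>m k l"
  proof (rule eq_matI)
    fix i j assume "i < dim_row (0\<^sub>m k l :: 'a mat)" "j < dim_col (0\<^sub>m k l :: 'a mat)"
    then show "(mat_adjoint Q\<^sub>1 * Q\<^sub>2) $$ (i, j) = 0\<^sub>m k l $$ (i, j)"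
      using adjoint_mult_index[OF Q1(1) Q2(1), of i j] col1[of i] col2[of j]
      by (simp add: orth_compl_def)
  qed (use Q1 Q2 in auto)
  have z21: "mat_adjoint Q\<^sub>2 * Q\<^sub>1 = 0\<^sub>m l k"
  proof (rule eq_matI)
    fix i j assume "i < dim_row (0\<^sub>m l k :: 'a mat)" "j < dim_col (0\<^sub>m l k :: 'a mat)"
    then show "(mat_adjoint Q\<^sub>2 * Q\<^sub>1) $$ (i, j) = 0\<^sub>m l k $$ (i, j)"
      using adjoint_mult_index[OF Q2(1) Q1(1), of i j] orth_compl_commute[OF Wc col2[of i] col1[of j]]
      by simp
  qed (use Q1 Q2 in auto)
  define P\<^sub>1 P\<^sub>2 where "P\<^sub>1 = Q\<^sub>1 * mat_adjoint Q\<^sub>1" and "P\<^sub>2 = Q\<^sub>2 * mat_adjoint Q\<^sub>2"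
  have P1: "orth_projector n W P\<^sub>1"
    using orth_projector_of_basis[OF Q1(1,2)] Q1(3) by (simp add: P\<^sub>1_def)
  have P2: "orth_projector n (orth_compl n W) P\<^sub>2"
    using orth_projector_of_basis[OF Q2(1,2)] Q2(3) by (simp add: P\<^sub>2_def)
  have Pc: "P\<^sub>1 \<in> carrier_mat n n" "P\<^sub>2 \<in> carrier_mat n n"
    using P1 P2 by (auto simp: orth_projector_def)
  have one: "P\<^sub>1 + P\<^sub>2 = 1\<^sub>m n"
  proof (rule mat_eq_vecI)
    fix x :: "'a vec" assume x: "x \<in> carrier_vec n"
    have c: "P\<^sub>1 *\<^sub>v x \<in> carrier_vec n" "P\<^sub>2 *\<^sub>v x \<in> carrier_vec n" using Pc x by auto
    have "P\<^sub>1 *\<^sub>v x \<in> orth_compl n (orth_compl n W)"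
      unfolding double_orth_compl[OF W] using P1 x by (simp add: orth_projector_def)
    then have z: "P\<^sub>2 *\<^sub>v (P\<^sub>1 *\<^sub>v x) = 0\<^sub>v n"
      using orth_projector_eq_0_iff[OF P2 Wc' c(1)] by simp
    \<comment> \<open>The residual of \<open>P\<^sub>1\<close> lies in the complement and is
      therefore fixed by \<open>P\<^sub>2\<close>.\<close>
    have "x - P\<^sub>1 *\<^sub>v x = P\<^sub>2 *\<^sub>v (x - P\<^sub>1 *\<^sub>v x)"
      using orth_projector_residual[OF P1 Wc x] P2 by (simp add: orth_projector_def)
    also have "\<dots> = P\<^sub>2 *\<^sub>v x"
      using z Pc x c by (simp add: mult_minus_distrib_mat_vec[of _ n n])
    finally have r: "x - P\<^sub>1 *\<^sub>v x = P\<^sub>2 *\<^sub>v x" .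
    have "(P\<^sub>1 + P\<^sub>2) *\<^sub>v x = x - P\<^sub>1 *\<^sub>v x + P\<^sub>1 *\<^sub>v x"
      unfolding r add_mult_distrib_mat_vec[OF Pc x] using c by (rule comm_add_vec)
    also have "\<dots> = x" by (rule vec_diff_add_cancel[OF x c(1)])
    finally show "(P\<^sub>1 + P\<^sub>2) *\<^sub>v x = 1\<^sub>m n *\<^sub>v x" using x by simp
  qed (use Pc in auto)
  have h: "hcat Q\<^sub>1 Q\<^sub>2 \<in> carrier_mat n (k + l)" using Q1 Q2 by simp
  \<comment> \<open>The joined matrix has its adjoint as a left and as a right inverse; each
    identity bounds one dimension by the other.\<close>
  have "k + l \<le> n"
    using hcat_orthonormal[OF Q1(1) Q2(1) Q1(2) Q2(2) z12] h
    by (intro left_inverse_dim_le[of "mat_adjoint (hcat Q\<^sub>1 Q\<^sub>2)" _ _ "hcat Q\<^sub>1 Q\<^sub>2"]) auto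
  moreover have "n \<le> k + l"
    using hcat_mult_adjoint[OF Q1(1) Q2(1)] one h unfolding P\<^sub>1_def P\<^sub>2_def
    by (intro left_inverse_dim_le[of "hcat Q\<^sub>1 Q\<^sub>2" _ _ "mat_adjoint (hcat Q\<^sub>1 Q\<^sub>2)"]) auto
  ultimately have "k + l = n" by simp
  then show thesis
    using that[OF Q1(1) Q2(1) _ Q1(2) Q2(2) z12 z21 _ Q1(3) Q2(3)] one
    unfolding P\<^sub>1_def P\<^sub>2_def by simp
qed

section \<open>Right equivalence of matrices with equal range\<close>

text \<open>Each column of \<open>B\<close> has a preimage under \<open>A\<close>; the chosen
  preimages form the columns of \<open>X\<close>.\<close>

lemma mat_factor:
  fixes A B :: "'a :: semiring_1 mat"
  assumes A: "A \<in> carrier_mat m n" and B: "B \<in> carrier_mat m l"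
    and sub: "mat_range B \<subseteq> mat_range A"
  obtains X where "X \<in> carrier_mat n l" "B = A * X"
proof -
  have "\<exists>x. x \<in> carrier_vec n \<and> col B j = A *\<^sub>v x" if j: "j < l" for j
  proof -
    have "col B j \<in> mat_range B"
      unfolding mult_unit_vec_col[OF B j, symmetric] mat_range_eq[OF B] by simp
    then show ?thesis using sub by (auto simp: mat_range_eq[OF A])
  qed
  then obtain f where f: "\<And>j. j < l \<Longrightarrow> f j \<in> carrier_vec n \<and> col B j = A *\<^sub>v f j" by metis
  define X where "X = mat_of_cols n (map f [0..<l])"
  have X: "X \<in> carrier_mat n l" by (simp add: X_def mat_of_cols_def)
  have "B = A * X"
  proof (rule mat_col_eqI)
    fix j assume "j < dim_col (A * X)"
    then have j: "j < l" using X by simp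
    then have "col X j = f j" using f[OF j] by (simp add: X_def)
    then show "col B j = col (A * X) j" using f[OF j] col_mult2[OF A X j] by simp
  qed (use A B X in auto)
  then show thesis using that X by blast
qed

lemma mat_left_cancel:
  fixes C X Y :: "'a :: ring_1 mat"
  assumes C: "C \<in> carrier_mat m l" and X: "X \<in> carrier_mat l k" and Y: "Y \<in> carrier_mat l k"
    and inj: "\<And>x. x \<in> carrier_vec l \<Longrightarrow> C *\<^sub>v x = 0\<^sub>v m \<Longrightarrow> x = 0\<^sub>v l"
    and eq: "C * X = C * Y"
  shows "X = Y"
proof (rule mat_eq_vecI[OF X Y])
  fix v :: "'a vec" assume v: "v \<in> carrier_vec k"
  have c: "X *\<^sub>v v \<in> carrier_vec l" "Y *\<^sub>v v \<in> carrier_vec l" using X Y v by auto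
  have "C *\<^sub>v (X *\<^sub>v v) = C *\<^sub>v (Y *\<^sub>v v)"
    using assoc_mult_mat_vec[OF C X v] assoc_mult_mat_vec[OF C Y v] eq by simp
  moreover have "C *\<^sub>v (Y *\<^sub>v v) \<in> carrier_vec m" using C c by simp
  ultimately have "C *\<^sub>v (X *\<^sub>v v - Y *\<^sub>v v) = 0\<^sub>v m"
    using mult_minus_distrib_mat_vec[OF C c] by simp
  then have "X *\<^sub>v v - Y *\<^sub>v v = 0\<^sub>v l" using inj c by simp
  then have "X *\<^sub>v v - Y *\<^sub>v v + Y *\<^sub>v v = Y *\<^sub>v v" using c by simp
  then show "X *\<^sub>v v = Y *\<^sub>v v" using vec_diff_add_cancel[OF c] by simp
qed

section \<open>Factoring out the kernel\<close>

lemma mult_mat_zero_vec: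
  "M \<in> carrier_mat m n \<Longrightarrow> M *\<^sub>v 0\<^sub>v n = (0\<^sub>v m :: 'a :: semiring_0 vec)"
  by (intro eq_vecI) (auto simp: scalar_prod_def)

lemma zero_mat_mult_vec: "y \<in> carrier_vec k \<Longrightarrow> 0\<^sub>m l k *\<^sub>v y = (0\<^sub>v l :: 'a :: semiring_0 vec)"
  by (intro eq_vecI) (auto simp: scalar_prod_def)

lemma vec_subspace_null_space:
  assumes M: "M \<in> carrier_mat m n"
  shows "vec_subspace n {x \<in> carrier_vec n. M *\<^sub>v x = 0\<^sub>v m}"
  unfolding vec_subspace_def
  using M by (auto simp: mult_add_distrib_mat_vec[OF M] mult_mat_vec[OF M] mult_mat_zero_vec)

text \<open>A full-rank factorization: \<open>Q\<^sub>1\<close> spans the kernel of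
  \<open>M\<close>, \<open>Q\<^sub>2\<close> its complement, and \<open>C\<close> is the restriction
  of \<open>M\<close> to that complement. Inserting the resolution of the identity behind
  \<open>M\<close> leaves only the \<open>Q\<^sub>2\<close> term.\<close>

lemma kernel_factorization:
  fixes M :: "'a :: real_or_complex mat"
  assumes M: "M \<in> carrier_mat m n"
  obtains k l Q\<^sub>1 Q\<^sub>2 C where "Q\<^sub>1 \<in> carrier_mat n k" "Q\<^sub>2 \<in> carrier_mat n l" "k + l = n"
    "mat_adjoint Q\<^sub>1 * Q\<^sub>1 = 1\<^sub>m k" "mat_adjoint Q\<^sub>2 * Q\<^sub>2 = 1\<^sub>m l" "mat_adjoint Q\<^sub>1 * Q\<^sub>2 = 0\<^sub>m k l"
    "mat_adjoint Q\<^sub>2 * Q\<^sub>1 = 0\<^sub>m l k"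
    "Q\<^sub>1 * mat_adjoint Q\<^sub>1 + Q\<^sub>2 * mat_adjoint Q\<^sub>2 = 1\<^sub>m n"
    "C \<in> carrier_mat m l" "M * Q\<^sub>1 = 0\<^sub>m m k" "M * Q\<^sub>2 = C" "M = C * mat_adjoint Q\<^sub>2"
    "\<And>x. x \<in> carrier_vec l \<Longrightarrow> C *\<^sub>v x = 0\<^sub>v m \<Longrightarrow> x = 0\<^sub>v l"
    "mat_range C = mat_range M"
proof -
  obtain k l Q\<^sub>1 Q\<^sub>2 where Q: "Q\<^sub>1 \<in> carrier_mat n k" "Q\<^sub>2 \<in> carrier_mat n l" "k + l = n"
    "mat_adjoint Q\<^sub>1 * Q\<^sub>1 = 1\<^sub>m k" "mat_adjoint Q\<^sub>2 * Q\<^sub>2 = 1\<^sub>m l" "mat_adjoint Q\<^sub>1 * Q\<^sub>2 = 0\<^sub>m k l"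
    "mat_adjoint Q\<^sub>2 * Q\<^sub>1 = 0\<^sub>m l k"
    "Q\<^sub>1 * mat_adjoint Q\<^sub>1 + Q\<^sub>2 * mat_adjoint Q\<^sub>2 = 1\<^sub>m n"
    and range: "mat_range Q\<^sub>1 = {x \<in> carrier_vec n. M *\<^sub>v x = 0\<^sub>v m}"
    by (rule orthogonal_decomposition[OF vec_subspace_null_space[OF M]])
  have Q': "mat_adjoint Q\<^sub>1 \<in> carrier_mat k n" "mat_adjoint Q\<^sub>2 \<in> carrier_mat l n" using Q by auto
  define C where "C = M * Q\<^sub>2"
  have C: "C \<in> carrier_mat m l" unfolding C_def using M Q(2) by simp
  have z: "M * Q\<^sub>1 = 0\<^sub>m m k"
  proof (rule mat_eq_vecI)
    fix x :: "'a vec" assume x: "x \<in> carrier_vec k"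
    then have "Q\<^sub>1 *\<^sub>v x \<in> mat_range Q\<^sub>1" using mat_range_eq[OF Q(1)] by blast
    then show "(M * Q\<^sub>1) *\<^sub>v x = 0\<^sub>m m k *\<^sub>v x"
      using range x assoc_mult_mat_vec[OF M Q(1) x] by auto
  qed (use M Q in auto)
  have "M = M * (Q\<^sub>1 * mat_adjoint Q\<^sub>1 + Q\<^sub>2 * mat_adjoint Q\<^sub>2)" using M Q(8) by simp
  also have "\<dots> = M * (Q\<^sub>1 * mat_adjoint Q\<^sub>1) + M * (Q\<^sub>2 * mat_adjoint Q\<^sub>2)"
    using M Q(1,2) Q' by (intro mult_add_distrib_mat) auto
  also have "\<dots> = M * Q\<^sub>1 * mat_adjoint Q\<^sub>1 + M * Q\<^sub>2 * mat_adjoint Q\<^sub>2"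
    using assoc_mult_mat[OF M Q(1) Q'(1)] assoc_mult_mat[OF M Q(2) Q'(2)] by simp
  also have "\<dots> = C * mat_adjoint Q\<^sub>2"
    unfolding z C_def[symmetric] left_mult_zero_mat[OF Q'(1)]
    by (rule left_add_zero_mat) (use Q' C in auto)
  finally have MC: "M = C * mat_adjoint Q\<^sub>2" .
  \<comment> \<open>If \<open>C\<close> annihilates \<open>x\<close>, then
    \<open>Q\<^sub>2 *\<^sub>v x\<close> lies in the kernel of \<open>M\<close>, the range of
    \<open>Q\<^sub>1\<close>; \<open>mat_adjoint Q\<^sub>2\<close> maps this range to zero but
    returns \<open>x\<close>.\<close>
  have inj: "x = 0\<^sub>v l" if x: "x \<in> carrier_vec l" and Cx: "C *\<^sub>v x = 0\<^sub>v m" for x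
  proof -
    have "Q\<^sub>2 *\<^sub>v x \<in> mat_range Q\<^sub>1"
      using Cx assoc_mult_mat_vec[OF M Q(2) x] Q(2) x by (simp add: range C_def)
    then obtain y where y: "y \<in> carrier_vec k" "Q\<^sub>2 *\<^sub>v x = Q\<^sub>1 *\<^sub>v y"
      using mat_range_eq[OF Q(1)] by blast
    have "x = mat_adjoint Q\<^sub>2 *\<^sub>v (Q\<^sub>2 *\<^sub>v x)"
      using assoc_mult_mat_vec[OF Q'(2) Q(2) x] Q(5) x by simp
    also have "\<dots> = 0\<^sub>v l"
      using assoc_mult_mat_vec[OF Q'(2) Q(1) y(1)] Q(7) y zero_mat_mult_vec[OF y(1)] by simp
    finally show ?thesis .
  qed
  have "mat_range C = mat_range M"
  proof
    show "mat_range C \<subseteq> mat_range M"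
    proof
      fix v assume "v \<in> mat_range C"
      then obtain x where x: "x \<in> carrier_vec l" "v = C *\<^sub>v x" using mat_range_eq[OF C] by blast
      then have "v = M *\<^sub>v (Q\<^sub>2 *\<^sub>v x)" using assoc_mult_mat_vec[OF M Q(2) x(1)] by (simp add: C_def)
      then show "v \<in> mat_range M" using mat_range_eq[OF M] Q(2) x by auto
    qed
    show "mat_range M \<subseteq> mat_range C"
    proof
      fix v assume "v \<in> mat_range M"
      then obtain x where x: "x \<in> carrier_vec n" "v = M *\<^sub>v x" using mat_range_eq[OF M] by blast
      then have "v = C *\<^sub>v (mat_adjoint Q\<^sub>2 *\<^sub>v x)"
        using assoc_mult_mat_vec[OF C Q'(2) x(1)] MC by simp
      moreover have "mat_adjoint Q\<^sub>2 *\<^sub>v x \<in> carrier_vec l" using Q'(2) x by simp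
      ultimately show "v \<in> mat_range C" using mat_range_eq[OF C] by blast
    qed
  qed
  then show thesis using that[OF Q C z C_def[symmetric] MC inj] by blast
qed

text \<open>Biorthogonality of the inner factors removes the cross terms. This serves to verify the
  explicit inverse of the transformation built next.\<close>

lemma mult_sum_biorthogonal:
  fixes A\<^sub>1 A\<^sub>2 B\<^sub>1 B\<^sub>2 C\<^sub>1 C\<^sub>2 D\<^sub>1 D\<^sub>2 :: "'a :: semiring_1 mat"
  assumes A: "A\<^sub>1 \<in> carrier_mat n k" "A\<^sub>2 \<in> carrier_mat n l"
    and B: "B\<^sub>1 \<in> carrier_mat k n" "B\<^sub>2 \<in> carrier_mat l n"
    and C: "C\<^sub>1 \<in> carrier_mat n k" "C\<^sub>2 \<in> carrier_mat n l"
    and D: "D\<^sub>1 \<in> carrier_mat k n" "D\<^sub>2 \<in> carrier_mat l n"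
    and BC: "B\<^sub>1 * C\<^sub>1 = 1\<^sub>m k" "B\<^sub>1 * C\<^sub>2 = 0\<^sub>m k l" "B\<^sub>2 * C\<^sub>1 = 0\<^sub>m l k" "B\<^sub>2 * C\<^sub>2 = 1\<^sub>m l"
  shows "(A\<^sub>1 * B\<^sub>1 + A\<^sub>2 * B\<^sub>2) * (C\<^sub>1 * D\<^sub>1 + C\<^sub>2 * D\<^sub>2) = A\<^sub>1 * D\<^sub>1 + A\<^sub>2 * D\<^sub>2"
proof -
  have B1: "B\<^sub>1 * (C\<^sub>1 * D\<^sub>1 + C\<^sub>2 * D\<^sub>2) = D\<^sub>1"
  proof -
    have "B\<^sub>1 * (C\<^sub>1 * D\<^sub>1 + C\<^sub>2 * D\<^sub>2) = B\<^sub>1 * (C\<^sub>1 * D\<^sub>1) + B\<^sub>1 * (C\<^sub>2 * D\<^sub>2)"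
      using B C D by (intro mult_add_distrib_mat) auto
    also have "\<dots> = B\<^sub>1 * C\<^sub>1 * D\<^sub>1 + B\<^sub>1 * C\<^sub>2 * D\<^sub>2"
      using assoc_mult_mat[OF B(1) C(1) D(1)] assoc_mult_mat[OF B(1) C(2) D(2)] by simp
    also have "\<dots> = D\<^sub>1" using BC D by simp
    finally show ?thesis .
  qed
  have B2: "B\<^sub>2 * (C\<^sub>1 * D\<^sub>1 + C\<^sub>2 * D\<^sub>2) = D\<^sub>2"
  proof -
    have "B\<^sub>2 * (C\<^sub>1 * D\<^sub>1 + C\<^sub>2 * D\<^sub>2) = B\<^sub>2 * (C\<^sub>1 * D\<^sub>1) + B\<^sub>2 * (C\<^sub>2 * D\<^sub>2)"
      using B C D by (intro mult_add_distrib_mat) auto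
    also have "\<dots> = B\<^sub>2 * C\<^sub>1 * D\<^sub>1 + B\<^sub>2 * C\<^sub>2 * D\<^sub>2"
      using assoc_mult_mat[OF B(2) C(1) D(1)] assoc_mult_mat[OF B(2) C(2) D(2)] by simp
    also have "\<dots> = D\<^sub>2" using BC D by simp
    finally show ?thesis .
  qed
  have X: "C\<^sub>1 * D\<^sub>1 + C\<^sub>2 * D\<^sub>2 \<in> carrier_mat n n" using C D by simp
  have "(A\<^sub>1 * B\<^sub>1 + A\<^sub>2 * B\<^sub>2) * (C\<^sub>1 * D\<^sub>1 + C\<^sub>2 * D\<^sub>2) =
      A\<^sub>1 * B\<^sub>1 * (C\<^sub>1 * D\<^sub>1 + C\<^sub>2 * D\<^sub>2) + A\<^sub>2 * B\<^sub>2 * (C\<^sub>1 * D\<^sub>1 + C\<^sub>2 * D\<^sub>2)"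
    using A B X by (intro add_mult_distrib_mat) auto
  then show ?thesis
    using assoc_mult_mat[OF A(1) B(1) X] assoc_mult_mat[OF A(2) B(2) X] B1 B2 by simp
qed

text \<open>The injective factors \<open>C\<close> and \<open>D\<close> have the same range, hence
  differ by an invertible \<open>G\<close>. Then \<open>T\<close> carries the kernel of
  \<open>N\<close> isometrically onto that of \<open>M\<close> and acts as \<open>G\<close> between
  the complements.\<close>

lemma equal_range_right_equivalent:
  fixes M N :: "'a :: real_or_complex mat"
  assumes M: "M \<in> carrier_mat m n" and N: "N \<in> carrier_mat m n"
    and range: "mat_range M = mat_range N"
  obtains T where "T \<in> carrier_mat n n" "invertible_mat T" "N = M * T"
proof -
  obtain k l Q\<^sub>1 Q\<^sub>2 C where Q: "Q\<^sub>1 \<in> carrier_mat n k" "Q\<^sub>2 \<in> carrier_mat n l" "k + l = n"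
    "mat_adjoint Q\<^sub>1 * Q\<^sub>1 = 1\<^sub>m k" "mat_adjoint Q\<^sub>2 * Q\<^sub>2 = 1\<^sub>m l" "mat_adjoint Q\<^sub>1 * Q\<^sub>2 = 0\<^sub>m k l"
    "mat_adjoint Q\<^sub>2 * Q\<^sub>1 = 0\<^sub>m l k" "Q\<^sub>1 * mat_adjoint Q\<^sub>1 + Q\<^sub>2 * mat_adjoint Q\<^sub>2 = 1\<^sub>m n"
    and C: "C \<in> carrier_mat m l" and MQ: "M * Q\<^sub>1 = 0\<^sub>m m k" "M * Q\<^sub>2 = C"
    and "M = C * mat_adjoint Q\<^sub>2"
    and C_inj: "\<And>x. x \<in> carrier_vec l \<Longrightarrow> C *\<^sub>v x = 0\<^sub>v m \<Longrightarrow> x = 0\<^sub>v l"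
    and C_range: "mat_range C = mat_range M"
    by (rule kernel_factorization[OF M], rule that)
  obtain k' l' R\<^sub>1 R\<^sub>2 D where R: "R\<^sub>1 \<in> carrier_mat n k'" "R\<^sub>2 \<in> carrier_mat n l'" "k' + l' = n"
    "mat_adjoint R\<^sub>1 * R\<^sub>1 = 1\<^sub>m k'" "mat_adjoint R\<^sub>2 * R\<^sub>2 = 1\<^sub>m l'"
    "mat_adjoint R\<^sub>1 * R\<^sub>2 = 0\<^sub>m k' l'" "mat_adjoint R\<^sub>2 * R\<^sub>1 = 0\<^sub>m l' k'"
 "R\<^sub>1 * mat_adjoint R\<^sub>1 + R\<^sub>2 * mat_adjoint R\<^sub>2 = 1\<^sub>m n"
    and D: "D \<in> carrier_mat m l'" and "N * R\<^sub>1 = 0\<^sub>m m k'" "N * R\<^sub>2 = D"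
    and ND: "N = D * mat_adjoint R\<^sub>2"
    and D_inj: "\<And>x. x \<in> carrier_vec l' \<Longrightarrow> D *\<^sub>v x = 0\<^sub>v m \<Longrightarrow> x = 0\<^sub>v l'"
    and D_range: "mat_range D = mat_range N"
    by (rule kernel_factorization[OF N], rule that)
  obtain G where G: "G \<in> carrier_mat l l'" "D = C * G"
    using mat_factor[OF C D] C_range D_range range by auto
  obtain H where H: "H \<in> carrier_mat l' l" "C = D * H"
    using mat_factor[OF D C] C_range D_range range by auto
  \<comment> \<open>Going from \<open>C\<close> to \<open>D\<close> and back gives \<open>C\<close>
    again; injectivity of \<open>C\<close> turns this into \<open>G * H = 1\<close>.\<close>
  have "C * (G * H) = C * 1\<^sub>m l"
    using assoc_mult_mat[OF C G(1) H(1)] right_mult_one_mat[OF C] G(2) H(2) by metis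
  then have GH: "G * H = 1\<^sub>m l"
    by (intro mat_left_cancel[OF C mult_carrier_mat[OF G(1) H(1)] one_carrier_mat]; blast intro: C_inj)
  have "D * (H * G) = D * 1\<^sub>m l'"
    using assoc_mult_mat[OF D H(1) G(1)] right_mult_one_mat[OF D] G(2) H(2) by metis
  then have HG: "H * G = 1\<^sub>m l'"
    by (intro mat_left_cancel[OF D mult_carrier_mat[OF H(1) G(1)] one_carrier_mat]; blast intro: D_inj)
  \<comment> \<open>The ranks agree, and so do the kernel dimensions since both matrices have
    \<open>n\<close> columns. Only then can \<open>Q\<^sub>1\<close> be multiplied by
    \<open>mat_adjoint R\<^sub>1\<close>.\<close>
  have l: "l' = l"
    using left_inverse_dim_le[OF G(1) H(1) GH] left_inverse_dim_le[OF H(1) G(1) HG] by simp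
  then have k: "k' = k" using Q(3) R(3) by simp
  note R = R[unfolded k l] and G1 = G(1)[unfolded l] and H1 = H(1)[unfolded l]
  have Q': "mat_adjoint Q\<^sub>1 \<in> carrier_mat k n" "mat_adjoint Q\<^sub>2 \<in> carrier_mat l n" using Q by auto
  have R': "mat_adjoint R\<^sub>1 \<in> carrier_mat k n" "mat_adjoint R\<^sub>2 \<in> carrier_mat l n" using R by auto
  have QG: "Q\<^sub>2 * G \<in> carrier_mat n l" and HQ: "H * mat_adjoint Q\<^sub>2 \<in> carrier_mat l n"
    using Q(2) G1 H1 Q'(2) by simp_all
  define T where "T = Q\<^sub>1 * mat_adjoint R\<^sub>1 + Q\<^sub>2 * G * mat_adjoint R\<^sub>2"
  define T' where "T' = R\<^sub>1 * mat_adjoint Q\<^sub>1 + R\<^sub>2 * (H * mat_adjoint Q\<^sub>2)"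
  have T: "T \<in> carrier_mat n n" "T' \<in> carrier_mat n n"
    unfolding T_def T'_def using Q R Q' R' QG HQ by auto
  have "T * T' = Q\<^sub>1 * mat_adjoint Q\<^sub>1 + Q\<^sub>2 * G * (H * mat_adjoint Q\<^sub>2)"
    unfolding T_def T'_def by (rule mult_sum_biorthogonal) (use Q R Q' R' QG HQ in auto)
  also have "Q\<^sub>2 * G * (H * mat_adjoint Q\<^sub>2) = Q\<^sub>2 * (G * (H * mat_adjoint Q\<^sub>2))"
    by (rule assoc_mult_mat[OF Q(2) G1 HQ])
  also have "G * (H * mat_adjoint Q\<^sub>2) = mat_adjoint Q\<^sub>2"
    using assoc_mult_mat[OF G1 H1 Q'(2)] GH left_mult_one_mat[OF Q'(2)] by metis
  finally have TT: "T * T' = 1\<^sub>m n" using Q(8) by simp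
  then have "T' * T = 1\<^sub>m n" using mat_mult_left_right_inverse T by blast
  then have inv: "invertible_mat T"
    using TT T unfolding invertible_mat_def inverts_mat_def by auto
  have "M * T = M * (Q\<^sub>1 * mat_adjoint R\<^sub>1) + M * (Q\<^sub>2 * G * mat_adjoint R\<^sub>2)"
    unfolding T_def using M Q R' QG by (intro mult_add_distrib_mat) auto
  also have "\<dots> = M * Q\<^sub>1 * mat_adjoint R\<^sub>1 + M * (Q\<^sub>2 * G) * mat_adjoint R\<^sub>2"
    using assoc_mult_mat[OF M Q(1) R'(1)] assoc_mult_mat[OF M QG R'(2)] by simp
  also have "M * (Q\<^sub>2 * G) = D"
    using assoc_mult_mat[OF M Q(2) G1] MQ G(2) by metis
  also have "M * Q\<^sub>1 * mat_adjoint R\<^sub>1 + D * mat_adjoint R\<^sub>2 = N"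
    unfolding MQ left_mult_zero_mat[OF R'(1)] ND[unfolded l, symmetric] using N by (rule left_add_zero_mat)
  finally show thesis using that T inv by metis
qed

text \<open>One \<open>T\<close> has to serve both matrices at once, so the previous result is
  applied to the matrices stacked by \<open>@\<^sub>r\<close>.\<close>

lemma equal_stacked_range_right_equivalent:
  fixes E A E' A' :: "'a :: real_or_complex mat"
  assumes E: "E \<in> carrier_mat n n" and A: "A \<in> carrier_mat n n"
    and E': "E' \<in> carrier_mat n n" and A': "A' \<in> carrier_mat n n"
    and range: "stacked_range n E A = stacked_range n E' A'"
  obtains T where "T \<in> carrier_mat n n" "invertible_mat T" "E' = E * T" "A' = A * T"
proof -
  \<comment> \<open>Concatenation translates between pairs of vectors and vectors of length
    \<open>2 n\<close>.\<close>
  have image: "mat_range (X @\<^sub>r Y) = (\<lambda>(x, y). x @\<^sub>v y) ` stacked_range n X Y"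
    if "X \<in> carrier_mat n n" "Y \<in> carrier_mat n n" for X Y :: "'a mat"
    unfolding mat_range_eq[OF carrier_append_rows[OF that]] stacked_range_def
    using mat_mult_append[OF that] by force
  have "mat_range (E @\<^sub>r A) = mat_range (E' @\<^sub>r A')"
    using image E A E' A' range by simp
  then obtain T where T: "T \<in> carrier_mat n n" "invertible_mat T" "E' @\<^sub>r A' = (E @\<^sub>r A) * T"
    using equal_range_right_equivalent[OF carrier_append_rows[OF E A] carrier_append_rows[OF E' A']]
    by metis
  have eq: "E' *\<^sub>v v = (E * T) *\<^sub>v v \<and> A' *\<^sub>v v = (A * T) *\<^sub>v v" if v: "v \<in> carrier_vec n" for v
  proof -
    have Tv: "T *\<^sub>v v \<in> carrier_vec n" using T(1) v by simp
    have "E' *\<^sub>v v @\<^sub>v A' *\<^sub>v v = ((E @\<^sub>r A) * T) *\<^sub>v v"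
      using mat_mult_append[OF E' A' v] T(3) by simp
    also have "\<dots> = E *\<^sub>v (T *\<^sub>v v) @\<^sub>v A *\<^sub>v (T *\<^sub>v v)"
      using assoc_mult_mat_vec[OF carrier_append_rows[OF E A] T(1) v] mat_mult_append[OF E A Tv]
      by simp
    finally have "E' *\<^sub>v v = E *\<^sub>v (T *\<^sub>v v) \<and> A' *\<^sub>v v = A *\<^sub>v (T *\<^sub>v v)"
      using E E' v Tv by (subst (asm) append_vec_eq[of _ n]) auto
    then show ?thesis
      using assoc_mult_mat_vec[OF E T(1) v] assoc_mult_mat_vec[OF A T(1) v] by simp
  qed
  have "E' = E * T" "A' = A * T"
    using eq E A E' A' T(1) by (auto intro!: mat_eq_vecI[of _ n n])
  then show thesis using that T by blast
qed

section \<open>Linear relations\<close>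

lemma conjugate_of_real [simp]: "conjugate (of_real r :: 'a :: real_or_complex) = of_real r"
proof (cases "r = 0")
  case False
  \<comment> \<open>The class axiom for the norm gives \<open>r * conjugate r = r * r\<close>, from
    which the nonzero \<open>r\<close> cancels.\<close>
  have "(of_real r :: 'a) * conjugate (of_real r) = of_real r * of_real r"
    by (simp add: mult_conjugate_norm power2_eq_square)
  then show ?thesis using False by simp
qed simp

text \<open>Identities for \<open>re\<close> are verified after embedding by the injective
  \<open>of_real\<close>, where the class axiom expresses \<open>re\<close> through
  \<open>conjugate\<close>.\<close>

lemma re_of_real [simp]: "re (of_real r :: 'a :: real_or_complex) = r"
proof -
  have "(of_real (re (of_real r :: 'a)) :: 'a) = of_real r" by (simp add: of_real_re)
  then show ?thesis by (simp only: of_real_eq_iff)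
qed

lemma re_add: "re (x + y) = re x + re y" for x y :: "'a :: real_or_complex"
proof -
  have "(of_real (re (x + y)) :: 'a) = of_real (re x + re y)"
    unfolding of_real_add of_real_re conjugate_dist_add by (simp add: field_simps)
  then show ?thesis by (simp only: of_real_eq_iff)
qed

lemma re_conjugate [simp]: "re (conjugate x) = re x" for x :: "'a :: real_or_complex"
proof -
  have "(of_real (re (conjugate x)) :: 'a) = of_real (re x)"
    unfolding of_real_re by (simp add: add.commute)
  then show ?thesis by (simp only: of_real_eq_iff)
qed

section \<open>Subspaces attached to a linear relation\<close>

lemma linear_relationD:
  assumes "linear_relation n M"
  shows "(x, y) \<in> M \<Longrightarrow> x \<in> carrier_vec n" "(x, y) \<in> M \<Longrightarrow> y \<in> carrier_vec n"
    "(0\<^sub>v n, 0\<^sub>v n) \<in> M"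
    "(x, y) \<in> M \<Longrightarrow> (x', y') \<in> M \<Longrightarrow> (x + x', y + y') \<in> M"
    "(x, y) \<in> M \<Longrightarrow> (c \<cdot>\<^sub>v x, c \<cdot>\<^sub>v y) \<in> M"
  using assms unfolding linear_relation_def by blast+

lemma linear_relation_diff:
  assumes M: "linear_relation n M" and "(x, y) \<in> M" "(x', y') \<in> M"
  shows "(x - x', y - y') \<in> M"
proof -
  have "x \<in> carrier_vec n" "y \<in> carrier_vec n" "x' \<in> carrier_vec n" "y' \<in> carrier_vec n"
    using assms linear_relationD(1,2)[OF M] by blast+
  then have "x - x' = x + (- 1) \<cdot>\<^sub>v x'" "y - y' = y + (- 1) \<cdot>\<^sub>v y'"
    by (intro eq_vecI; simp)+
  then show ?thesis using linear_relationD(4,5)[OF M] assms(2,3) by metis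
qed

text \<open>Passing to the converse exchanges domain with range and kernel with multi-valued part,
  so one of each pair has to be treated directly.\<close>

lemma linear_relation_converse:
  assumes M: "linear_relation n M"
  shows "linear_relation n (M\<inverse>)"
  using assms unfolding linear_relation_def by auto

lemma vec_subspace_Range:
  assumes M: "linear_relation n M"
  shows "vec_subspace n (Range M)"
  unfolding vec_subspace_def using linear_relationD[OF M] by (fast intro: RangeI)

lemma vec_subspace_Domain:
  assumes M: "linear_relation n M"
  shows "vec_subspace n (Domain M)"
  using vec_subspace_Range[OF linear_relation_converse[OF M]] by simp

lemma vec_subspace_rel_mul:
  assumes M: "linear_relation n M"
  shows "vec_subspace n (rel_mul n M)"
proof -
  have "rel_mul n M \<subseteq> carrier_vec n" "0\<^sub>v n \<in> rel_mul n M"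
    using linear_relationD(2,3)[OF M] by (auto simp: rel_mul_def)
  moreover have "x + y \<in> rel_mul n M" if "x \<in> rel_mul n M" "y \<in> rel_mul n M" for x y
    using linear_relationD(4)[OF M, of "0\<^sub>v n" x "0\<^sub>v n" y] that by (simp add: rel_mul_def)
  moreover have "c \<cdot>\<^sub>v x \<in> rel_mul n M" if "x \<in> rel_mul n M" for c x
  proof -
    have "c \<cdot>\<^sub>v 0\<^sub>v n = (0\<^sub>v n :: 'a vec)" by (intro eq_vecI) auto
    then show ?thesis
      using linear_relationD(5)[OF M, of "0\<^sub>v n" x c] that by (simp add: rel_mul_def)
  qed
  ultimately show ?thesis unfolding vec_subspace_def by simp
qed

lemma vec_subspace_rel_ker:
  assumes M: "linear_relation n M"
  shows "vec_subspace n (rel_ker n M)"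
  using vec_subspace_rel_mul[OF linear_relation_converse[OF M]] by (simp add: rel_mul_def rel_ker_def)

lemma vec_subspace_Int: "vec_subspace n V \<Longrightarrow> vec_subspace n W \<Longrightarrow> vec_subspace n (V \<inter> W)"
  unfolding vec_subspace_def by blast

section \<open>Orthogonality forced by symmetry and dissipativity\<close>

lemma symmetric_relationD:
  assumes "symmetric_relation n M" "(x, y) \<in> M" "(x', y') \<in> M"
  shows "y \<bullet>c x' = x \<bullet>c y'"
  using assms unfolding symmetric_relation_def rel_adjoint_def by blast

lemma dissipative_relationD:
  "dissipative_relation M \<Longrightarrow> (x, y) \<in> M \<Longrightarrow> re (x \<bullet>c y) \<le> 0"
  unfolding dissipative_relation_def by blast

text \<open>Symmetry applied to \<open>(x, 0)\<close> and \<open>(x', y)\<close> equates the inner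
  product of \<open>x\<close> and \<open>y\<close> with that of \<open>0\<close> and
  \<open>x'\<close>.\<close>

lemma rel_ker_orth_Range:
  assumes M: "linear_relation n M" and sym: "symmetric_relation n M"
  shows "rel_ker n M \<subseteq> orth_compl n (Range M)"
proof
  fix x assume "x \<in> rel_ker n M"
  then have x: "(x, 0\<^sub>v n) \<in> M" by (simp add: rel_ker_def)
  have xc: "x \<in> carrier_vec n" using linear_relationD(1)[OF M x] .
  have "x \<bullet>c y = 0" if "(x', y) \<in> M" for x' y
    using symmetric_relationD[OF sym x that] linear_relationD(1)[OF M that] by simp
  then show "x \<in> orth_compl n (Range M)" using xc by (auto simp: orth_compl_def)
qed

text \<open>
  For \<open>(x, y), (0, z) \<in> M\<close> the dissipation inequality at \<open>(x, y + k z)\<close> for all scalars \<open>k\<close>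
  forces \<open>\<langle>x, z\<rangle> = 0\<close>.
\<close>
lemma rel_mul_orth_Domain:
  assumes M: "linear_relation n M" and diss: "dissipative_relation M"
  shows "rel_mul n M \<subseteq> orth_compl n (Domain M)"
proof
  fix z assume "z \<in> rel_mul n M"
  then have z: "(0\<^sub>v n, z) \<in> M" by (simp add: rel_mul_def)
  have zc: "z \<in> carrier_vec n" using linear_relationD(2)[OF M z] .
  have "z \<bullet>c x = 0" if xy: "(x, y) \<in> M" for x y
  proof (rule ccontr)
    assume nz: "z \<bullet>c x \<noteq> 0"
    have c: "x \<in> carrier_vec n" "y \<in> carrier_vec n" using linear_relationD(1,2)[OF M xy] .
    define a where "a = x \<bullet>c z"
    have "conjugate a \<noteq> 0" using nz cscalar_commute[OF c(1) zc] by (simp add: a_def)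
    then have a: "norm a > 0" by simp
    \<comment> \<open>With this \<open>t\<close> the added term \<open>conjugate k * a\<close> is
      the real number \<open>1 - re (x \<bullet>c y)\<close>, so the real part becomes exactly 1 and
      contradicts dissipativity.\<close>
    define t where "t = (1 - re (x \<bullet>c y)) / (norm a)\<^sup>2"
    define k where "k = of_real t * a"
    have "(x + k \<cdot>\<^sub>v 0\<^sub>v n, y + k \<cdot>\<^sub>v z) \<in> M"
      using linear_relationD(4,5)[OF M] xy z by blast
    moreover have "x + k \<cdot>\<^sub>v 0\<^sub>v n = x" using c by (intro eq_vecI) auto
    ultimately have "re (x \<bullet>c (y + k \<cdot>\<^sub>v z)) \<le> 0"
      using dissipative_relationD[OF diss] by metis
    moreover have "x \<bullet>c (y + k \<cdot>\<^sub>v z) = x \<bullet>c y + conjugate k * a"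
      using c zc by (simp add: conjugate_add_vec[of _ n] conjugate_smult_vec
          scalar_prod_add_distrib[of _ n] a_def)
    moreover have "conjugate k * a = of_real (t * (norm a)\<^sup>2)"
      using mult_conjugate_norm[of a] by (simp add: k_def conjugate_dist_mul ac_simps)
    moreover have "t * (norm a)\<^sup>2 = 1 - re (x \<bullet>c y)" using a by (simp add: t_def)
    ultimately have "re (x \<bullet>c y) + (1 - re (x \<bullet>c y)) \<le> 0"
      by (simp only: re_add re_of_real)
    then show False by simp
  qed
  then show "z \<in> orth_compl n (Domain M)" using zc by (auto simp: orth_compl_def)
qed

section \<open>Matrices with columns in a linear relation\<close>

lemma linear_relation_mat_mult:
  fixes S Q :: "'a :: real_or_complex mat"
  assumes M: "linear_relation n M" and S: "S \<in> carrier_mat n k" and Q: "Q \<in> carrier_mat n k"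
    and cols: "\<And>j. j < k \<Longrightarrow> (col S j, col Q j) \<in> M" and y: "y \<in> carrier_vec k"
  shows "(S *\<^sub>v y, Q *\<^sub>v y) \<in> M"
proof -
  \<comment> \<open>Truncate \<open>y\<close> to its first \<open>m\<close> entries and induct on \<open>m\<close>.\<close>
  define t where "t m = vec k (\<lambda>i. if i < m then y $ i else 0)" for m
  have "(S *\<^sub>v t m, Q *\<^sub>v t m) \<in> M" if "m \<le> k" for m
    using that
  proof (induction m)
    case 0
    have "t 0 = 0\<^sub>v k" by (intro eq_vecI) (auto simp: t_def)
    then show ?case using mult_mat_zero_vec[OF S] mult_mat_zero_vec[OF Q] linear_relationD(3)[OF M]
      by simp
  next
    case (Suc m)
    then have m: "m < k" by simp
    have tm: "t m \<in> carrier_vec k" by (simp add: t_def)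
    have split: "t (Suc m) = t m + y $ m \<cdot>\<^sub>v unit_vec k m"
      using m by (intro eq_vecI) (auto simp: t_def less_Suc_eq)
    have "X *\<^sub>v t (Suc m) = X *\<^sub>v t m + y $ m \<cdot>\<^sub>v col X m" if "X \<in> carrier_mat n k" for X :: "'a mat"
      unfolding split using that tm m
      by (simp add: mult_add_distrib_mat_vec[of _ n k] mult_mat_vec[of _ n k] mult_unit_vec_col[of _ n k])
    then show ?case
      using S Q Suc cols[OF m] linear_relationD(4,5)[OF M] by simp
  qed
  moreover have "t k = y" using y by (intro eq_vecI) (auto simp: t_def)
  ultimately show ?thesis by auto
qed

text \<open>Preimages are chosen for the columns only; linearity extends them to a linear selection
  on the whole range of \<open>Q\<close>.\<close>

lemma linear_relation_preimage_mat:
  fixes Q :: "'a :: real_or_complex mat"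
  assumes M: "linear_relation n M" and Q: "Q \<in> carrier_mat n k" and sub: "mat_range Q \<subseteq> Range M"
  obtains S where "S \<in> carrier_mat n k" "\<And>y. y \<in> carrier_vec k \<Longrightarrow> (S *\<^sub>v y, Q *\<^sub>v y) \<in> M"
proof -
  have "\<exists>x. (x, col Q j) \<in> M" if j: "j < k" for j
  proof -
    have "col Q j \<in> mat_range Q"
      unfolding mult_unit_vec_col[OF Q j, symmetric] mat_range_eq[OF Q] by simp
    then show ?thesis using sub by auto
  qed
  then obtain f where f: "\<And>j. j < k \<Longrightarrow> (f j, col Q j) \<in> M" by metis
  define S where "S = mat_of_cols n (map f [0..<k])"
  have S: "S \<in> carrier_mat n k" by (simp add: S_def mat_of_cols_def)
  have "col S j = f j" if j: "j < k" for j
    using linear_relationD(1)[OF M f[OF j]] j by (simp add: S_def)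
  then have "(S *\<^sub>v y, Q *\<^sub>v y) \<in> M" if "y \<in> carrier_vec k" for y
    using linear_relation_mat_mult[OF M S Q _ that] f by simp
  then show thesis using that S by blast
qed

text \<open>The two Gram entries at \<open>(i, j)\<close> are the two sides of the symmetry identity
  for the pairs of columns \<open>j\<close> and \<open>i\<close>. This yields the Hermitian block
  \<open>L\<^sub>1\<^sub>1\<close>.\<close>

lemma symmetric_compression:
  fixes S Q :: "'a :: real_or_complex mat"
  assumes sym: "symmetric_relation n M" and S: "S \<in> carrier_mat n k" and Q: "Q \<in> carrier_mat n k"
    and SQ: "\<And>y. y \<in> carrier_vec k \<Longrightarrow> (S *\<^sub>v y, Q *\<^sub>v y) \<in> M"
  shows "mat_adjoint (mat_adjoint Q * S) = mat_adjoint Q * S"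
proof -
  have adj: "mat_adjoint (mat_adjoint Q * S) = mat_adjoint S * Q"
    using adjoint_mult[of "mat_adjoint Q" k n S k] S Q by simp
  show ?thesis
    unfolding adj
  proof (rule eq_matI)
    fix i j assume "i < dim_row (mat_adjoint Q * S)" "j < dim_col (mat_adjoint Q * S)"
    then have ij: "i < k" "j < k" using S Q by auto
    have "(col S l, col Q l) \<in> M" if "l < k" for l
      using SQ[of "unit_vec k l"] mult_unit_vec_col[OF S that] mult_unit_vec_col[OF Q that] by simp
    then show "(mat_adjoint S * Q) $$ (i, j) = (mat_adjoint Q * S) $$ (i, j)"
      using symmetric_relationD[OF sym] ij
        adjoint_mult_index[OF S Q ij] adjoint_mult_index[OF Q S ij] by simp
  qed (use S Q in auto)
qed

text \<open>The quadratic form of \<open>K = mat_adjoint Q * B\<close> at \<open>x\<close> has the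
  real part that dissipativity controls at the pair \<open>(Q x, B x)\<close>, and
  \<open>mat_adjoint K\<close> contributes the same real part. This yields the condition on
  \<open>D\<^sub>1\<^sub>1\<close>.\<close>

lemma dissipative_compression:
  fixes B Q :: "'a :: real_or_complex mat"
  assumes diss: "dissipative_relation M" and B: "B \<in> carrier_mat n k" and Q: "Q \<in> carrier_mat n k"
    and QB: "\<And>y. y \<in> carrier_vec k \<Longrightarrow> (Q *\<^sub>v y, B *\<^sub>v y) \<in> M"
  shows "neg_semidef_mat (mat_adjoint Q * B + mat_adjoint (mat_adjoint Q * B))"
proof -
  define K where "K = mat_adjoint Q * B"
  have Q': "mat_adjoint Q \<in> carrier_mat k n" using Q by simp
  have K: "K \<in> carrier_mat k k" "mat_adjoint K \<in> carrier_mat k k"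
    unfolding K_def using mult_carrier_mat[OF Q' B] by auto
  have "re (((K + mat_adjoint K) *\<^sub>v x) \<bullet>c x) \<le> 0" if x: "x \<in> carrier_vec k" for x
  proof -
    have c: "Q *\<^sub>v x \<in> carrier_vec n" "B *\<^sub>v x \<in> carrier_vec n" "K *\<^sub>v x \<in> carrier_vec k"
      "mat_adjoint K *\<^sub>v x \<in> carrier_vec k"
      using Q B x mult_mat_vec_carrier[OF K(1) x] mult_mat_vec_carrier[OF K(2) x] by simp_all
    have "(K *\<^sub>v x) \<bullet>c x = (mat_adjoint Q *\<^sub>v (B *\<^sub>v x)) \<bullet>c x"
      unfolding K_def assoc_mult_mat_vec[OF Q' B x] ..
    also have "\<dots> = (B *\<^sub>v x) \<bullet>c (Q *\<^sub>v x)" by (rule cscalar_adjoint'[OF Q c(2) x])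
    also have "\<dots> = conjugate ((Q *\<^sub>v x) \<bullet>c (B *\<^sub>v x))" using cscalar_commute[OF c(1,2)] by simp
    finally have "re ((K *\<^sub>v x) \<bullet>c x) = re ((Q *\<^sub>v x) \<bullet>c (B *\<^sub>v x))" by simp
    then have 1: "re ((K *\<^sub>v x) \<bullet>c x) \<le> 0"
      using dissipative_relationD[OF diss QB[OF x]] by simp
    have "(mat_adjoint K *\<^sub>v x) \<bullet>c x = conjugate ((K *\<^sub>v x) \<bullet>c x)"
      using cscalar_adjoint'[OF K(1) x x] cscalar_commute[OF c(3) x] by simp
    then have 2: "re ((mat_adjoint K *\<^sub>v x) \<bullet>c x) = re ((K *\<^sub>v x) \<bullet>c x)" by simp
    have "((K + mat_adjoint K) *\<^sub>v x) \<bullet>c x = (K *\<^sub>v x) \<bullet>c x + (mat_adjoint K *\<^sub>v x) \<bullet>c x"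
      unfolding add_mult_distrib_mat_vec[OF K x]
      using c x by (simp add: add_scalar_prod_distrib[of _ k])
    then show ?thesis using 1 2 by (simp add: re_add)
  qed
  moreover have "mat_adjoint (K + mat_adjoint K) = K + mat_adjoint K"
    using adjoint_add[OF K] comm_add_mat[OF K] by simp
  ultimately show ?thesis unfolding neg_semidef_mat_def K_def[symmetric] using K by auto
qed

section \<open>Regular pencils\<close>

text \<open>Through this homomorphism matrix products and determinants pass from scalars to constant
  polynomials.\<close>

lemma const_poly_hom: "comm_ring_hom (\<lambda>a :: 'a :: comm_ring_1. [:a:])"
  by unfold_locales (auto simp: one_pCons)

lemma pencil_carrier [simp, intro]:
  "E \<in> carrier_mat m n \<Longrightarrow> A \<in> carrier_mat m n \<Longrightarrow> pencil E A \<in> carrier_mat m n"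
  unfolding pencil_def by auto

lemma pencil_mult:
  fixes X Y E A :: "'a :: real_or_complex mat"
  assumes X: "X \<in> carrier_mat n n" and Y: "Y \<in> carrier_mat n n"
    and E: "E \<in> carrier_mat n n" and A: "A \<in> carrier_mat n n"
  shows "const_poly_mat X * pencil E A * const_poly_mat Y = pencil (X * E * Y) (X * A * Y)"
proof -
  interpret comm_ring_hom "\<lambda>a :: 'a. [:a:]" by (rule const_poly_hom)
  have c: "const_poly_mat M \<in> carrier_mat n n" if "M \<in> carrier_mat n n" for M :: "'a mat"
    using that by simp
  have sc: "[:0, 1:] \<cdot>\<^sub>m const_poly_mat M \<in> carrier_mat n n" if "M \<in> carrier_mat n n" for M :: "'a mat"
    using that by simp
  have XE: "X * E \<in> carrier_mat n n" "X * A \<in> carrier_mat n n" using X E A by auto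
  have "const_poly_mat X * pencil E A =
      [:0, 1:] \<cdot>\<^sub>m const_poly_mat (X * E) - const_poly_mat (X * A)"
    unfolding pencil_def mult_minus_distrib_mat[OF c[OF X] sc[OF E] c[OF A]]
      mult_smult_distrib[OF c[OF X] c[OF E]] mat_hom_mult[OF X E] mat_hom_mult[OF X A] ..
  then show ?thesis
    unfolding pencil_def using minus_mult_distrib_mat[OF sc[OF XE(1)] c[OF XE(2)] c[OF Y]]
      mult_smult_assoc_mat[OF c[OF XE(1)] c[OF Y]] mat_hom_mult[OF XE(1) Y] mat_hom_mult[OF XE(2) Y]
    by simp
qed

text \<open>The determinant of the pencil only picks up two nonzero constant factors.\<close>

lemma regular_pencil_mult:
  fixes X Y E A :: "'a :: real_or_complex mat"
  assumes X: "X \<in> carrier_mat n n" and Y: "Y \<in> carrier_mat n n"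
    and E: "E \<in> carrier_mat n n" and A: "A \<in> carrier_mat n n"
    and "det X \<noteq> 0" "det Y \<noteq> 0"
  shows "regular_pencil (X * E * Y) (X * A * Y) \<longleftrightarrow> regular_pencil E A"
proof -
  interpret comm_ring_hom "\<lambda>a :: 'a. [:a:]" by (rule const_poly_hom)
  have "det (const_poly_mat X * pencil E A * const_poly_mat Y) =
      [:det X:] * det (pencil E A) * [:det Y:]"
    using X Y pencil_carrier[OF E A] by (simp add: det_mult[of _ n])
  then show ?thesis
    unfolding regular_pencil_def pencil_mult[OF X Y E A] using assms by simp
qed

lemma pencil_four_block:
  fixes E\<^sub>1 A\<^sub>1 :: "'a :: real_or_complex mat"
  assumes "E\<^sub>1 \<in> carrier_mat k k" "A\<^sub>1 \<in> carrier_mat k k"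
    "E\<^sub>2 \<in> carrier_mat l k" "A\<^sub>2 \<in> carrier_mat l k" "E\<^sub>3 \<in> carrier_mat l l" "A\<^sub>3 \<in> carrier_mat l l"
  shows "pencil (four_block_mat E\<^sub>1 (0\<^sub>m k l) E\<^sub>2 E\<^sub>3) (four_block_mat A\<^sub>1 (0\<^sub>m k l) A\<^sub>2 A\<^sub>3) =
    four_block_mat (pencil E\<^sub>1 A\<^sub>1) (0\<^sub>m k l) (pencil E\<^sub>2 A\<^sub>2) (pencil E\<^sub>3 A\<^sub>3)"
  using assms by (intro eq_matI) (auto simp: pencil_def)

text \<open>The determinant of the triangular form is the product of the diagonal determinants, and
  polynomials over a field have no zero divisors.\<close>

lemma regular_pencil_four_block:
  fixes E\<^sub>1 A\<^sub>1 :: "'a :: real_or_complex mat"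
  assumes "E\<^sub>1 \<in> carrier_mat k k" "A\<^sub>1 \<in> carrier_mat k k"
    "E\<^sub>2 \<in> carrier_mat l k" "A\<^sub>2 \<in> carrier_mat l k" "E\<^sub>3 \<in> carrier_mat l l" "A\<^sub>3 \<in> carrier_mat l l"
  shows "regular_pencil (four_block_mat E\<^sub>1 (0\<^sub>m k l) E\<^sub>2 E\<^sub>3) (four_block_mat A\<^sub>1 (0\<^sub>m k l) A\<^sub>2 A\<^sub>3) \<longleftrightarrow>
    regular_pencil E\<^sub>1 A\<^sub>1 \<and> regular_pencil E\<^sub>3 A\<^sub>3"
  unfolding regular_pencil_def pencil_four_block[OF assms]
  using det_four_block_mat_upper_right_zero[OF pencil_carrier[OF assms(1,2)] refl
      pencil_carrier[OF assms(3,4)] pencil_carrier[OF assms(5,6)]]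
  by simp

section \<open>Pencils of two orthogonal projectors\<close>

lemma hermitian_idempotent_quadratic:
  fixes P :: "'a :: conjugatable_field mat"
  assumes P: "P \<in> carrier_mat n n" "mat_adjoint P = P" "P * P = P" and x: "x \<in> carrier_vec n"
  shows "(P *\<^sub>v x) \<bullet>c x = (P *\<^sub>v x) \<bullet>c (P *\<^sub>v x)"
proof -
  have Px: "P *\<^sub>v x \<in> carrier_vec n" using P x by simp
  have "(P *\<^sub>v x) \<bullet>c x = (P *\<^sub>v (P *\<^sub>v x)) \<bullet>c x"
    using assoc_mult_mat_vec[OF P(1) P(1) x] P(3) by simp
  also have "\<dots> = (P *\<^sub>v x) \<bullet>c (P *\<^sub>v x)" using cscalar_adjoint[OF P(1) Px x] P(2) by simp
  finally show ?thesis .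
qed

text \<open>The pencil is \<open>s P + Q\<close>. A common kernel vector is annihilated for every
  \<open>s\<close>; conversely, a singular value at \<open>s = 1\<close> produces a common kernel
  vector, since the quadratic forms of \<open>P\<close> and \<open>Q\<close> are squared
  norms.\<close>

lemma regular_projection_pencil:
  fixes P Q :: "'a :: real_or_complex mat"
  assumes P: "P \<in> carrier_mat n n" "mat_adjoint P = P" "P * P = P"
    and Q: "Q \<in> carrier_mat n n" "mat_adjoint Q = Q" "Q * Q = Q"
  shows "regular_pencil P (- Q) \<longleftrightarrow>
    (\<forall>x \<in> carrier_vec n. P *\<^sub>v x = 0\<^sub>v n \<longrightarrow> Q *\<^sub>v x = 0\<^sub>v n \<longrightarrow> x = 0\<^sub>v n)"
proof (intro iffI ballI impI)
  have Q': "- Q \<in> carrier_mat n n" using Q by simp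
  note pc = pencil_carrier[OF P(1) Q']
  {
    fix x assume reg: "regular_pencil P (- Q)" and x: "x \<in> carrier_vec n"
      and Px: "P *\<^sub>v x = 0\<^sub>v n" and Qx: "Q *\<^sub>v x = 0\<^sub>v n"
    interpret comm_ring_hom "\<lambda>a :: 'a. [:a:]" by (rule const_poly_hom)
    \<comment> \<open>The vector \<open>x\<close> is regarded as a vector of constant polynomials,
      so that the determinant criterion applies over the polynomial ring.\<close>
    define y where "y = map_vec (\<lambda>a. [:a:]) x"
    have y: "y \<in> carrier_vec n" using x by (simp add: y_def)
    have Qx': "- Q *\<^sub>v x = 0\<^sub>v n" using Qx Q(1) x by (simp add: carrier_matD carrier_vecD)
    have zero: "const_poly_mat M *\<^sub>v y = 0\<^sub>v n" if "M \<in> carrier_mat n n" "M *\<^sub>v x = 0\<^sub>v n" for M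
      unfolding y_def mult_mat_vec_hom[OF that(1) x, symmetric] that(2) by (intro eq_vecI) auto
    have c: "[:0, 1:] \<cdot>\<^sub>m const_poly_mat P \<in> carrier_mat n n" "const_poly_mat (- Q) \<in> carrier_mat n n"
      using P Q by auto
    have "([:0, 1:] \<cdot>\<^sub>m const_poly_mat P) *\<^sub>v y = [:0, 1:] \<cdot>\<^sub>v (const_poly_mat P *\<^sub>v y)"
      using P y by (intro eq_vecI) auto
    then have "pencil P (- Q) *\<^sub>v y = 0\<^sub>v n"
      unfolding pencil_def minus_mult_distrib_mat_vec[OF c y] zero[OF P(1) Px] zero[OF Q' Qx']
      by (intro eq_vecI) auto
    then have "y = 0\<^sub>v n"
      using reg det_0_iff_vec_prod_zero[OF pc] y unfolding regular_pencil_def by auto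
    show "x = 0\<^sub>v n"
    proof (rule eq_vecI)
      fix i assume i: "i < dim_vec (0\<^sub>v n :: 'a vec)"
      then have "y $ i = [:x $ i:]" using x by (simp add: y_def)
      then show "x $ i = 0\<^sub>v n $ i" using \<open>y = 0\<^sub>v n\<close> i by simp
    qed (use x in simp)
  }
  assume inj: "\<forall>x \<in> carrier_vec n. P *\<^sub>v x = 0\<^sub>v n \<longrightarrow> Q *\<^sub>v x = 0\<^sub>v n \<longrightarrow> x = 0\<^sub>v n"
  show "regular_pencil P (- Q)"
    unfolding regular_pencil_def
  proof
    assume det0: "det (pencil P (- Q)) = 0"
    have ev: "comm_ring_hom (\<lambda>p :: 'a poly. poly p 1)" by unfold_locales auto
    have "map_mat (\<lambda>p. poly p 1) (pencil P (- Q)) = P + Q"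
      using P Q by (intro eq_matI) (auto simp: pencil_def)
    then have "det (P + Q) = 0" using comm_ring_hom.hom_det[OF ev, of "pencil P (- Q)"] det0 by simp
    then obtain v where v: "v \<in> carrier_vec n" "v \<noteq> 0\<^sub>v n" "(P + Q) *\<^sub>v v = 0\<^sub>v n"
      using det_0_iff_vec_prod_zero_field[of "P + Q" n] P Q by auto
    have c: "P *\<^sub>v v \<in> carrier_vec n" "Q *\<^sub>v v \<in> carrier_vec n" using P Q v by auto
    have "P *\<^sub>v v + Q *\<^sub>v v = 0\<^sub>v n" using v(3) add_mult_distrib_mat_vec[OF P(1) Q(1) v(1)] by simp
    then have "(P *\<^sub>v v) \<bullet>c v + (Q *\<^sub>v v) \<bullet>c v = 0"
      using c v(1) add_scalar_prod_distrib[of "P *\<^sub>v v" n "Q *\<^sub>v v" "conjugate v"] by simp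
    then have "(P *\<^sub>v v) \<bullet>c (P *\<^sub>v v) + (Q *\<^sub>v v) \<bullet>c (Q *\<^sub>v v) = 0"
      using hermitian_idempotent_quadratic[OF P v(1)] hermitian_idempotent_quadratic[OF Q v(1)] by simp
    \<comment> \<open>Two nonnegative terms with sum zero both vanish.\<close>
    then have "(P *\<^sub>v v) \<bullet>c (P *\<^sub>v v) = 0 \<and> (Q *\<^sub>v v) \<bullet>c (Q *\<^sub>v v) = 0"
      by (subst (asm) add_nonneg_eq_0_iff) (rule conjugate_square_ge_0_vec)+
    then have "P *\<^sub>v v = 0\<^sub>v n" "Q *\<^sub>v v = 0\<^sub>v n" using c by simp_all
    then show False using inj v by blast
  qed
qed

text \<open>Here \<open>R\<close> is the projector \<open>P\<close> written in the coordinates given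
  by the columns of \<open>Q\<close>. As \<open>V\<close> lies in the range of \<open>Q\<close>,
  multiplying \<open>P\<close> by \<open>Q * mat_adjoint Q\<close> on the left changes nothing, and
  on the right neither by taking adjoints.\<close>

lemma projector_compression:
  fixes P Q :: "'a :: real_or_complex mat"
  assumes P: "orth_projector n V P" and Q: "Q \<in> carrier_mat n l" "mat_adjoint Q * Q = 1\<^sub>m l"
    and sub: "V \<subseteq> mat_range Q"
  defines "R \<equiv> mat_adjoint Q * (P * Q)"
  shows "R \<in> carrier_mat l l" "mat_adjoint R = R" "R * R = R" "Q * R = P * Q"
    "P * (Q * mat_adjoint Q) = P"
proof -
  have Pc: "P \<in> carrier_mat n n" "mat_adjoint P = P" using P by (auto simp: orth_projector_def)
  have Q': "mat_adjoint Q \<in> carrier_mat l n" using Q by simp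
  have QQ: "Q * mat_adjoint Q \<in> carrier_mat n n" using mult_carrier_mat[OF Q(1) Q'] .
  have PQ: "P * Q \<in> carrier_mat n l" using Pc Q by simp
  show Rc: "R \<in> carrier_mat l l" unfolding R_def using mult_carrier_mat[OF Q' PQ] .
  have QP: "mat_adjoint Q * P \<in> carrier_mat l n" using mult_carrier_mat[OF Q' Pc(1)] .
  have "mat_adjoint R = mat_adjoint Q * P * Q"
    unfolding R_def adjoint_mult[OF Q' PQ] adjoint_mult[OF Pc(1) Q(1)] Pc(2) by simp
  then show "mat_adjoint R = R" unfolding R_def using assoc_mult_mat[OF Q' Pc(1) Q(1)] by simp
  have QQP: "Q * mat_adjoint Q * P = P"
  proof (rule mat_eq_vecI)
    fix x :: "'a vec" assume x: "x \<in> carrier_vec n"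
    have "P *\<^sub>v x \<in> mat_range Q" using P x sub by (auto simp: orth_projector_def)
    then show "(Q * mat_adjoint Q * P) *\<^sub>v x = P *\<^sub>v x"
      using orth_projector_of_basis[OF Q] assoc_mult_mat_vec[OF QQ Pc(1) x]
      by (simp add: orth_projector_def)
  qed (use QQ Pc in auto)
  then have "mat_adjoint (Q * mat_adjoint Q * P) = P" using Pc by simp
  then show "P * (Q * mat_adjoint Q) = P"
    unfolding adjoint_mult[OF QQ Pc(1)] adjoint_mult[OF Q(1) Q'] Pc(2) by simp
  have "Q * R = Q * mat_adjoint Q * (P * Q)"
    unfolding R_def using assoc_mult_mat[OF Q(1) Q' PQ] by simp
  also have "\<dots> = Q * mat_adjoint Q * P * Q" using assoc_mult_mat[OF QQ Pc(1) Q(1)] by simp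
  finally show QR: "Q * R = P * Q" unfolding QQP .
  have "R * R = mat_adjoint Q * (P * Q * R)"
    unfolding R_def by (rule assoc_mult_mat[OF Q' PQ]) (use Rc in \<open>simp add: R_def\<close>)
  also have "P * Q * R = P * (P * Q)" using assoc_mult_mat[OF Pc(1) Q(1) Rc] QR by simp
  also have "\<dots> = P * P * Q" using assoc_mult_mat[OF Pc(1) Pc(1) Q(1)] by simp
  finally show "R * R = R" unfolding orth_projector_idem[OF P] R_def .
qed

text \<open>The common kernel consists of the coordinates of those vectors in the range of
  \<open>Q\<close> that are orthogonal to \<open>V + W\<close>; it is trivial exactly when
  \<open>V + W\<close> fills this range.\<close>

lemma common_kernel_iff_sum:
  fixes Q :: "'a :: real_or_complex mat"
  assumes V: "vec_subspace n V" and W: "vec_subspace n W"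
    and Q: "Q \<in> carrier_mat n l" "mat_adjoint Q * Q = 1\<^sub>m l" and Z: "vec_subspace n (mat_range Q)"
    and sub: "V \<subseteq> mat_range Q" "W \<subseteq> mat_range Q"
    and P\<^sub>V: "orth_projector n V P\<^sub>V" and P\<^sub>W: "orth_projector n W P\<^sub>W"
  shows "(\<forall>x \<in> carrier_vec l. (mat_adjoint Q * (P\<^sub>V * Q)) *\<^sub>v x = 0\<^sub>v l \<longrightarrow>
      (mat_adjoint Q * (P\<^sub>W * Q)) *\<^sub>v x = 0\<^sub>v l \<longrightarrow> x = 0\<^sub>v l) \<longleftrightarrow>
    subspace_sum V W = mat_range Q"
proof -
  have Q': "mat_adjoint Q \<in> carrier_mat l n" using Q by simp
  have inj: "x = 0\<^sub>v l" if "x \<in> carrier_vec l" "Q *\<^sub>v x = 0\<^sub>v n" for x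
    using assoc_mult_mat_vec[OF Q' Q(1) that(1)] that Q(2) mult_mat_zero_vec[OF Q'] by simp
  \<comment> \<open>The compressed projector satisfies \<open>Q * R = P * Q\<close>, and
    \<open>Q\<close> is injective, so \<open>R\<close> annihilates \<open>x\<close> iff
    \<open>P\<close> annihilates \<open>Q *\<^sub>v x\<close>.\<close>
  have ker: "(mat_adjoint Q * (P * Q)) *\<^sub>v x = 0\<^sub>v l \<longleftrightarrow> Q *\<^sub>v x \<in> orth_compl n X"
    if P: "orth_projector n X P" and X: "vec_subspace n X" "X \<subseteq> mat_range Q" and x: "x \<in> carrier_vec l"
    for P X x
  proof -
    note R = projector_compression[OF P Q X(2)]
    have Pc: "P \<in> carrier_mat n n" using P by (simp add: orth_projector_def)
    have PQ: "P * Q \<in> carrier_mat n l" using Pc Q by simp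
    have Qx: "Q *\<^sub>v x \<in> carrier_vec n" using Q x by simp
    have "P *\<^sub>v (Q *\<^sub>v x) = 0\<^sub>v n \<longleftrightarrow> Q *\<^sub>v x \<in> orth_compl n X"
      by (rule orth_projector_eq_0_iff[OF P vec_subspace_carrier[OF X(1)] Qx])
    moreover have "Q *\<^sub>v ((mat_adjoint Q * (P * Q)) *\<^sub>v x) = P *\<^sub>v (Q *\<^sub>v x)"
      using assoc_mult_mat_vec[OF Q(1) R(1) x] assoc_mult_mat_vec[OF Pc Q(1) x] R(4) by metis
    moreover have "(mat_adjoint Q * (P * Q)) *\<^sub>v x \<in> carrier_vec l" using R(1) x by simp
    ultimately show ?thesis using inj mult_mat_zero_vec[OF Q(1)] by metis
  qed
  note M = vec_subspace_sum[OF V W] and VM = subset_subspace_sum[OF V W]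
  note Mc = vec_subspace_carrier[OF M]
  have MZ: "subspace_sum V W \<subseteq> mat_range Q"
    using sub Z unfolding subspace_sum_def vec_subspace_def by blast
  have perp: "orth_compl n V \<inter> orth_compl n W \<subseteq> orth_compl n (subspace_sum V W)"
  proof
    fix z assume z: "z \<in> orth_compl n V \<inter> orth_compl n W"
    then have zc: "z \<in> carrier_vec n" by (simp add: orth_compl_def)
    have "z \<bullet>c (v + w) = 0" if vw: "v \<in> V" "w \<in> W" for v w
    proof -
      have "v \<in> carrier_vec n" "w \<in> carrier_vec n" using vw V W by (auto simp: vec_subspace_def)
      then show ?thesis
        using z zc vw
        by (simp add: conjugate_add_vec[of _ n] scalar_prod_add_distrib[of _ n] orth_compl_def)
    qed
    then show "z \<in> orth_compl n (subspace_sum V W)"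
      using zc by (auto simp: orth_compl_def subspace_sum_def)
  qed
  show ?thesis
  proof (intro iffI ballI impI)
    fix x assume eq: "subspace_sum V W = mat_range Q" and x: "x \<in> carrier_vec l"
      and k: "(mat_adjoint Q * (P\<^sub>V * Q)) *\<^sub>v x = 0\<^sub>v l" "(mat_adjoint Q * (P\<^sub>W * Q)) *\<^sub>v x = 0\<^sub>v l"
    have "Q *\<^sub>v x \<in> orth_compl n (subspace_sum V W)"
      using perp k ker[OF P\<^sub>V V sub(1) x] ker[OF P\<^sub>W W sub(2) x] by blast
    moreover have "Q *\<^sub>v x \<in> subspace_sum V W" unfolding eq mat_range_eq[OF Q(1)] using x by simp
    ultimately have "(Q *\<^sub>v x) \<bullet>c (Q *\<^sub>v x) = 0" by (simp add: orth_compl_def)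
    moreover have "Q *\<^sub>v x \<in> carrier_vec n" using Q x by simp
    ultimately show "x = 0\<^sub>v l" using inj[OF x] by simp
  next
    assume k: "\<forall>x \<in> carrier_vec l. (mat_adjoint Q * (P\<^sub>V * Q)) *\<^sub>v x = 0\<^sub>v l \<longrightarrow>
      (mat_adjoint Q * (P\<^sub>W * Q)) *\<^sub>v x = 0\<^sub>v l \<longrightarrow> x = 0\<^sub>v l"
    obtain P where P: "orth_projector n (subspace_sum V W) P" using orth_projector_exists[OF M] .
    have "z \<in> subspace_sum V W" if z: "z \<in> mat_range Q" for z
    proof -
      have zc: "z \<in> carrier_vec n" using z vec_subspace_carrier[OF Z] by auto
      have Pz: "P *\<^sub>v z \<in> subspace_sum V W" using P zc by (simp add: orth_projector_def)
      then have Pzc: "P *\<^sub>v z \<in> carrier_vec n" using Mc by auto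
      have res: "z - P *\<^sub>v z \<in> orth_compl n (subspace_sum V W)"
        by (rule orth_projector_residual[OF P Mc zc])
      \<comment> \<open>The residual stays in the range of \<open>Q\<close>, since
        \<open>V + W\<close> is contained in it; hence it has coordinates \<open>x\<close>, which
        lie in the common kernel.\<close>
      have "z - P *\<^sub>v z \<in> mat_range Q" using vec_subspace_diff[OF Z z] Pz MZ by auto
      then obtain x where x: "x \<in> carrier_vec l" "z - P *\<^sub>v z = Q *\<^sub>v x"
        using mat_range_eq[OF Q(1)] by blast
      have "Q *\<^sub>v x \<in> orth_compl n V" "Q *\<^sub>v x \<in> orth_compl n W"
        using res orth_compl_antimono[OF VM(1)] orth_compl_antimono[OF VM(2)] unfolding x(2) by auto
      then have "x = 0\<^sub>v l" using k x(1) ker[OF P\<^sub>V V sub(1) x(1)] ker[OF P\<^sub>W W sub(2) x(1)] by blast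
      then have "z - P *\<^sub>v z = 0\<^sub>v n" using x(2) mult_mat_zero_vec[OF Q(1)] by simp
      then have "P *\<^sub>v z = z" using vec_diff_add_cancel[OF zc Pzc] Pzc by simp
      then show ?thesis using Pz by simp
    qed
    then show "subspace_sum V W = mat_range Q" using MZ by blast
  qed
qed

section \<open>The block-triangular form\<close>

text \<open>For a fixed intermediate vector, preimages under \<open>\<L>\<close> differ by the
  kernel of \<open>\<L>\<close> and images under \<open>\<D>\<close> by the multi-valued part of
  \<open>\<D>\<close>. One parameter \<open>b\<close> covers both differences, thanks to
  \<open>simultaneous_projection\<close>.\<close>

lemma relation_product_parametrization:
  fixes \<L> \<D> :: "('a :: real_or_complex vec \<times> 'a vec) set"
  assumes L: "linear_relation n \<L>" and D: "linear_relation n \<D>"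
    and mk: "rel_mul n \<D> \<inter> rel_ker n \<L> = {0\<^sub>v n}"
    and Q: "Q \<in> carrier_mat n l"
    and P: "orth_projector n (rel_ker n \<L>) P" "P * (Q * mat_adjoint Q) = P"
    and P': "orth_projector n (rel_mul n \<D>) P'" "P' * (Q * mat_adjoint Q) = P'"
    and Y: "Y \<in> carrier_mat n k" "mat_range Y = Range \<L> \<inter> Domain \<D>"
    and S: "S \<in> carrier_mat n k" "\<And>a. a \<in> carrier_vec k \<Longrightarrow> (S *\<^sub>v a, Y *\<^sub>v a) \<in> \<L>"
    and B: "B \<in> carrier_mat n k" "\<And>a. a \<in> carrier_vec k \<Longrightarrow> (Y *\<^sub>v a, B *\<^sub>v a) \<in> \<D>"
  shows "\<L> O \<D> = {(S *\<^sub>v a + P *\<^sub>v (Q *\<^sub>v b), B *\<^sub>v a - P' *\<^sub>v (Q *\<^sub>v b)) | a b.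
    a \<in> carrier_vec k \<and> b \<in> carrier_vec l}" (is "_ = ?R")
proof
  note K = vec_subspace_rel_ker[OF L] and M = vec_subspace_rel_mul[OF D]
  have Q': "mat_adjoint Q \<in> carrier_mat l n" using Q by simp
  have QQ: "Q * mat_adjoint Q \<in> carrier_mat n n" using mult_carrier_mat[OF Q Q'] .
  have Pc: "P \<in> carrier_mat n n" "P' \<in> carrier_mat n n" using P P' by (auto simp: orth_projector_def)
  show "?R \<subseteq> \<L> O \<D>"
  proof
    fix p assume "p \<in> ?R"
    then obtain a b where ab: "a \<in> carrier_vec k" "b \<in> carrier_vec l"
      and p: "p = (S *\<^sub>v a + P *\<^sub>v (Q *\<^sub>v b), B *\<^sub>v a - P' *\<^sub>v (Q *\<^sub>v b))" by blast
    have Qb: "Q *\<^sub>v b \<in> carrier_vec n" and Ya: "Y *\<^sub>v a \<in> carrier_vec n" using Q Y(1) ab by auto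
    have "(P *\<^sub>v (Q *\<^sub>v b), 0\<^sub>v n) \<in> \<L>" "(0\<^sub>v n, P' *\<^sub>v (Q *\<^sub>v b)) \<in> \<D>"
      using P(1) P'(1) Qb by (auto simp: orth_projector_def rel_ker_def rel_mul_def)
    then have "(S *\<^sub>v a + P *\<^sub>v (Q *\<^sub>v b), Y *\<^sub>v a + 0\<^sub>v n) \<in> \<L>"
      "(Y *\<^sub>v a - 0\<^sub>v n, B *\<^sub>v a - P' *\<^sub>v (Q *\<^sub>v b)) \<in> \<D>"
      using linear_relationD(4)[OF L S(2)[OF ab(1)]] linear_relation_diff[OF D B(2)[OF ab(1)]] by blast+
    then show "p \<in> \<L> O \<D>" unfolding p using Ya by auto
  qed
  show "\<L> O \<D> \<subseteq> ?R"
  proof (rule subrelI)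
    fix x z assume "(x, z) \<in> \<L> O \<D>"
    then obtain y where xy: "(x, y) \<in> \<L>" and yz: "(y, z) \<in> \<D>" by blast
    then have "y \<in> mat_range Y" using Y(2) by blast
    then obtain a where a: "a \<in> carrier_vec k" "y = Y *\<^sub>v a" using mat_range_eq[OF Y(1)] by blast
    have c: "x \<in> carrier_vec n" "y \<in> carrier_vec n" "z \<in> carrier_vec n"
      "S *\<^sub>v a \<in> carrier_vec n" "B *\<^sub>v a \<in> carrier_vec n"
      using linear_relationD(1,2)[OF L xy] linear_relationD(2)[OF D yz] S(1) B(1) a by auto
    \<comment> \<open>The second difference is taken in the opposite order; this produces the minus
      sign in front of \<open>P'\<close> and later that of \<open>D\<^sub>2\<^sub>2\<close>.\<close>
    have "(x - S *\<^sub>v a, y - y) \<in> \<L>" "(y - y, B *\<^sub>v a - z) \<in> \<D>"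
      using linear_relation_diff[OF L xy S(2)[OF a(1)]] linear_relation_diff[OF D B(2)[OF a(1)] yz] a(2)
      by simp_all
    then have k: "x - S *\<^sub>v a \<in> rel_ker n \<L>" and m: "B *\<^sub>v a - z \<in> rel_mul n \<D>"
      using c by (simp_all add: rel_ker_def rel_mul_def)
    obtain u where u: "u \<in> carrier_vec n" "P *\<^sub>v u = x - S *\<^sub>v a" "P' *\<^sub>v u = B *\<^sub>v a - z"
      using simultaneous_projection[OF K M _ P(1) P'(1) k m] mk by (auto simp: Int_commute)
    \<comment> \<open>Replacing \<open>u\<close> by its coordinates loses nothing that
      \<open>P\<close> or \<open>P'\<close> can see, since both absorb
      \<open>Q * mat_adjoint Q\<close> on the right.\<close>
    define b where "b = mat_adjoint Q *\<^sub>v u"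
    have b: "b \<in> carrier_vec l" using Q' u(1) by (simp add: b_def)
    have Qb: "X *\<^sub>v (Q *\<^sub>v b) = X *\<^sub>v u" if "X \<in> carrier_mat n n" "X * (Q * mat_adjoint Q) = X" for X
      unfolding b_def using assoc_mult_mat_vec[OF Q Q' u(1)] assoc_mult_mat_vec[OF that(1) QQ u(1)] that(2)
      by simp
    have "s + (v - s) = v" "s - (s - v) = v" if "s \<in> carrier_vec n" "v \<in> carrier_vec n"
      for s v :: "'a vec"
      using that by (intro eq_vecI; auto)+
    then have "S *\<^sub>v a + P *\<^sub>v (Q *\<^sub>v b) = x" "B *\<^sub>v a - P' *\<^sub>v (Q *\<^sub>v b) = z"
      unfolding Qb[OF Pc(1) P(2)] Qb[OF Pc(2) P'(2)] u(2,3) using c by blast+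
    then show "(x, z) \<in> ?R" using a(1) b by blast
  qed
qed

text \<open>The first block column holds the coordinates of \<open>S\<close> in the joined basis,
  which the resolution of the identity turns back into \<open>S\<close>; the second acts only
  through \<open>Q\<^sub>2\<close>.\<close>

lemma hcat_mult_four_block:
  fixes Q\<^sub>1 Q\<^sub>2 S R :: "'a :: real_or_complex mat"
  assumes Q: "Q\<^sub>1 \<in> carrier_mat n k" "Q\<^sub>2 \<in> carrier_mat n l"
    "Q\<^sub>1 * mat_adjoint Q\<^sub>1 + Q\<^sub>2 * mat_adjoint Q\<^sub>2 = 1\<^sub>m n"
    and S: "S \<in> carrier_mat n k" and R: "R \<in> carrier_mat l l"
    and a: "a \<in> carrier_vec k" and b: "b \<in> carrier_vec l"
  shows "(hcat Q\<^sub>1 Q\<^sub>2 * four_block_mat (mat_adjoint Q\<^sub>1 * S) (0\<^sub>m k l) (mat_adjoint Q\<^sub>2 * S) R) *\<^sub>v (a @\<^sub>v b) =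
    S *\<^sub>v a + Q\<^sub>2 *\<^sub>v (R *\<^sub>v b)"
proof -
  have Q': "mat_adjoint Q\<^sub>1 \<in> carrier_mat k n" "mat_adjoint Q\<^sub>2 \<in> carrier_mat l n" using Q by auto
  have QS: "mat_adjoint Q\<^sub>1 * S \<in> carrier_mat k k" "mat_adjoint Q\<^sub>2 * S \<in> carrier_mat l k"
    using mult_carrier_mat[OF Q'(1) S] mult_carrier_mat[OF Q'(2) S] .
  have Sa: "S *\<^sub>v a \<in> carrier_vec n" using S a by simp
  define s t where "s = mat_adjoint Q\<^sub>1 *\<^sub>v (S *\<^sub>v a)" and "t = mat_adjoint Q\<^sub>2 *\<^sub>v (S *\<^sub>v a)"
  have c: "s \<in> carrier_vec k" "t \<in> carrier_vec l" "R *\<^sub>v b \<in> carrier_vec l"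
    using Q' Sa R b by (auto simp: s_def t_def)
  have q: "Q\<^sub>1 *\<^sub>v s \<in> carrier_vec n" "Q\<^sub>2 *\<^sub>v t \<in> carrier_vec n" "Q\<^sub>2 *\<^sub>v (R *\<^sub>v b) \<in> carrier_vec n"
    using Q c by auto
  let ?F = "four_block_mat (mat_adjoint Q\<^sub>1 * S) (0\<^sub>m k l) (mat_adjoint Q\<^sub>2 * S) R"
  have F: "?F \<in> carrier_mat (k + l) (k + l)" using four_block_carrier_mat[OF QS(1) R] .
  have "?F *\<^sub>v (a @\<^sub>v b) = (s + 0\<^sub>m k l *\<^sub>v b) @\<^sub>v (t + R *\<^sub>v b)"
    using four_block_mat_mult_vec[OF QS(1) zero_carrier_mat QS(2) R a b]
      assoc_mult_mat_vec[OF Q'(1) S a] assoc_mult_mat_vec[OF Q'(2) S a]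
    by (simp add: s_def t_def)
  also have "s + 0\<^sub>m k l *\<^sub>v b = s" using zero_mat_mult_vec[OF b] c by simp
  finally have "(hcat Q\<^sub>1 Q\<^sub>2 * ?F) *\<^sub>v (a @\<^sub>v b) = hcat Q\<^sub>1 Q\<^sub>2 *\<^sub>v (s @\<^sub>v (t + R *\<^sub>v b))"
    using assoc_mult_mat_vec[OF hcat_carrier[OF Q(1,2)] F append_carrier_vec[OF a b]] by simp
  also have "\<dots> = Q\<^sub>1 *\<^sub>v s + Q\<^sub>2 *\<^sub>v (t + R *\<^sub>v b)"
    by (rule hcat_mult_vec[OF Q(1,2) c(1)]) (use c in auto)
  also have "Q\<^sub>2 *\<^sub>v (t + R *\<^sub>v b) = Q\<^sub>2 *\<^sub>v t + Q\<^sub>2 *\<^sub>v (R *\<^sub>v b)"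
    by (rule mult_add_distrib_mat_vec[OF Q(2) c(2,3)])
  also have "Q\<^sub>1 *\<^sub>v s + (Q\<^sub>2 *\<^sub>v t + Q\<^sub>2 *\<^sub>v (R *\<^sub>v b)) = (Q\<^sub>1 *\<^sub>v s + Q\<^sub>2 *\<^sub>v t) + Q\<^sub>2 *\<^sub>v (R *\<^sub>v b)"
    using assoc_add_vec[OF q] by simp
  also have "Q\<^sub>1 *\<^sub>v s + Q\<^sub>2 *\<^sub>v t = (Q\<^sub>1 * mat_adjoint Q\<^sub>1 + Q\<^sub>2 * mat_adjoint Q\<^sub>2) *\<^sub>v (S *\<^sub>v a)"
    unfolding add_mult_distrib_mat_vec[OF mult_carrier_mat[OF Q(1) Q'(1)] mult_carrier_mat[OF Q(2) Q'(2)] Sa]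
    using assoc_mult_mat_vec[OF Q(1) Q'(1) Sa] assoc_mult_mat_vec[OF Q(2) Q'(2) Sa]
    by (simp add: s_def t_def)
  also have "\<dots> = S *\<^sub>v a" unfolding Q(3) using Sa by simp
  finally show ?thesis .
qed

lemma invertible_det_nonzero:
  fixes T :: "'a :: field mat"
  assumes T: "T \<in> carrier_mat n n" and inv: "invertible_mat T"
  shows "det T \<noteq> 0"
proof -
  \<comment> \<open>\<open>invertible_mat\<close> supplies an inverse without its format; the
    dimensions are read off from the two identities.\<close>
  obtain T' where T': "T * T' = 1\<^sub>m n" "T' * T = 1\<^sub>m (dim_row T')"
    using inv T unfolding invertible_mat_def inverts_mat_def by auto
  have "dim_col T' = n" using arg_cong[OF T'(1), of dim_col] by simp
  moreover have "dim_row T' = n" using arg_cong[OF T'(2), of dim_col] T by simp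
  ultimately have "T' \<in> carrier_mat n n" by auto
  then have "det T * det T' = 1" using det_mult[OF T] T'(1) by (metis det_one)
  then show ?thesis by auto
qed

theorem proposition5p1:
  fixes E A :: "'a :: real_or_complex mat"
    and \<D> \<L> :: "('a vec \<times> 'a vec) set"
    and n :: nat
  assumes "E \<in> carrier_mat n n" and "A \<in> carrier_mat n n"
    and "linear_relation n \<D>" and "dissipative_relation \<D>"
    and "linear_relation n \<L>" and "symmetric_relation n \<L>"
    and "stacked_range n E A = \<L> O \<D>"
    and "rel_mul n \<D> \<inter> rel_ker n \<L> = {0\<^sub>v n}"
  shows "\<exists>U T n\<^sub>1 n\<^sub>2 L\<^sub>1\<^sub>1 L\<^sub>2\<^sub>1 L\<^sub>2\<^sub>2 D\<^sub>1\<^sub>1 D\<^sub>2\<^sub>1 D\<^sub>2\<^sub>2.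
     U \<in> carrier_mat n n \<and> unitary_mat U \<and>
     T \<in> carrier_mat n n \<and> invertible_mat T \<and>
     L\<^sub>1\<^sub>1 \<in> carrier_mat n\<^sub>1 n\<^sub>1 \<and> D\<^sub>1\<^sub>1 \<in> carrier_mat n\<^sub>1 n\<^sub>1 \<and>
     L\<^sub>2\<^sub>1 \<in> carrier_mat n\<^sub>2 n\<^sub>1 \<and> D\<^sub>2\<^sub>1 \<in> carrier_mat n\<^sub>2 n\<^sub>1 \<and>
     L\<^sub>2\<^sub>2 \<in> carrier_mat n\<^sub>2 n\<^sub>2 \<and> D\<^sub>2\<^sub>2 \<in> carrier_mat n\<^sub>2 n\<^sub>2 \<and>
     const_poly_mat (mat_adjoint U) * pencil E A * const_poly_mat T =
       four_block_mat (pencil L\<^sub>1\<^sub>1 D\<^sub>1\<^sub>1) (0\<^sub>m n\<^sub>1 n\<^sub>2)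
                      (pencil L\<^sub>2\<^sub>1 D\<^sub>2\<^sub>1) (pencil L\<^sub>2\<^sub>2 D\<^sub>2\<^sub>2) \<and>
     L\<^sub>1\<^sub>1 = mat_adjoint L\<^sub>1\<^sub>1 \<and>
     neg_semidef_mat (D\<^sub>1\<^sub>1 + mat_adjoint D\<^sub>1\<^sub>1) \<and>
     L\<^sub>2\<^sub>2 = L\<^sub>2\<^sub>2 * L\<^sub>2\<^sub>2 \<and> L\<^sub>2\<^sub>2 * L\<^sub>2\<^sub>2 = mat_adjoint L\<^sub>2\<^sub>2 \<and>
     - D\<^sub>2\<^sub>2 = D\<^sub>2\<^sub>2 * D\<^sub>2\<^sub>2 \<and> D\<^sub>2\<^sub>2 * D\<^sub>2\<^sub>2 = - mat_adjoint D\<^sub>2\<^sub>2 \<and>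
     (regular_pencil E A \<longleftrightarrow>
        regular_pencil L\<^sub>1\<^sub>1 D\<^sub>1\<^sub>1 \<and>
        subspace_sum (rel_ker n \<L>) (rel_mul n \<D>) =
          subspace_sum (orth_compl n (Range \<L>)) (orth_compl n (Domain \<D>)))"
proof -
  note E = assms(1) and A = assms(2) and D = assms(3) and L = assms(5)
  define V W where "V = rel_ker n \<L>" and "W = rel_mul n \<D>"
  have V: "vec_subspace n V" and W: "vec_subspace n W"
    using vec_subspace_rel_ker[OF L] vec_subspace_rel_mul[OF D] by (simp_all add: V_def W_def)
  have Y: "vec_subspace n (Range \<L> \<inter> Domain \<D>)"
    by (rule vec_subspace_Int[OF vec_subspace_Range[OF L] vec_subspace_Domain[OF D]])
  obtain k l Q\<^sub>1 Q\<^sub>2 where Q: "Q\<^sub>1 \<in> carrier_mat n k" "Q\<^sub>2 \<in> carrier_mat n l" "k + l = n"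
    "mat_adjoint Q\<^sub>1 * Q\<^sub>1 = 1\<^sub>m k" "mat_adjoint Q\<^sub>2 * Q\<^sub>2 = 1\<^sub>m l" "mat_adjoint Q\<^sub>1 * Q\<^sub>2 = 0\<^sub>m k l"
    "mat_adjoint Q\<^sub>2 * Q\<^sub>1 = 0\<^sub>m l k"
    "Q\<^sub>1 * mat_adjoint Q\<^sub>1 + Q\<^sub>2 * mat_adjoint Q\<^sub>2 = 1\<^sub>m n"
    "mat_range Q\<^sub>1 = Range \<L> \<inter> Domain \<D>" "mat_range Q\<^sub>2 = orth_compl n (Range \<L> \<inter> Domain \<D>)"
    by (rule orthogonal_decomposition[OF Y])
  \<comment> \<open>The kernel is orthogonal to the range of \<open>\<L>\<close> and the
    multi-valued part to the domain of \<open>\<D>\<close>, hence both are orthogonal to the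
    intersection of these spaces.\<close>
  have sub: "V \<subseteq> mat_range Q\<^sub>2" "W \<subseteq> mat_range Q\<^sub>2"
    unfolding Q(10) V_def W_def
    using rel_ker_orth_Range[OF L assms(6)] rel_mul_orth_Domain[OF D assms(4)]
      orth_compl_antimono[of "Range \<L> \<inter> Domain \<D>" "Range \<L>"]
      orth_compl_antimono[of "Range \<L> \<inter> Domain \<D>" "Domain \<D>"]
    by blast+
  have Z: "vec_subspace n (mat_range Q\<^sub>2)"
    unfolding Q(10) by (rule vec_subspace_orth_compl[OF vec_subspace_carrier[OF Y]])
  obtain P where P: "orth_projector n V P" using orth_projector_exists[OF V] .
  obtain P' where P': "orth_projector n W P'" using orth_projector_exists[OF W] .
  obtain S where S: "S \<in> carrier_mat n k" "\<And>a. a \<in> carrier_vec k \<Longrightarrow> (S *\<^sub>v a, Q\<^sub>1 *\<^sub>v a) \<in> \<L>"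
    using linear_relation_preimage_mat[OF L Q(1)] Q(9) by blast
  \<comment> \<open>Images rather than preimages are selected here, so the selection lemma is
    applied to the converse of \<open>\<D>\<close>.\<close>
  obtain B where B: "B \<in> carrier_mat n k" "\<And>a. a \<in> carrier_vec k \<Longrightarrow> (Q\<^sub>1 *\<^sub>v a, B *\<^sub>v a) \<in> \<D>"
  proof (rule linear_relation_preimage_mat[OF linear_relation_converse[OF D] Q(1)])
    show "mat_range Q\<^sub>1 \<subseteq> Range (\<D>\<inverse>)" using Q(9) by auto
  qed (use that in auto)
  \<comment> \<open>The projectors in the coordinates of the complement: \<open>R\<close> becomes
    \<open>L\<^sub>2\<^sub>2\<close> and \<open>- R'\<close> becomes
    \<open>D\<^sub>2\<^sub>2\<close>.\<close>
  define R where "R = mat_adjoint Q\<^sub>2 * (P * Q\<^sub>2)"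
  define R' where "R' = mat_adjoint Q\<^sub>2 * (P' * Q\<^sub>2)"
  note R = projector_compression[OF P Q(2,5) sub(1), folded R_def]
  note R' = projector_compression[OF P' Q(2,5) sub(2), folded R'_def]
  have Q': "mat_adjoint Q\<^sub>1 \<in> carrier_mat k n" "mat_adjoint Q\<^sub>2 \<in> carrier_mat l n" using Q by auto
  have blocks: "mat_adjoint Q\<^sub>1 * S \<in> carrier_mat k k" "mat_adjoint Q\<^sub>1 * B \<in> carrier_mat k k"
    "mat_adjoint Q\<^sub>2 * S \<in> carrier_mat l k" "mat_adjoint Q\<^sub>2 * B \<in> carrier_mat l k"
    "R \<in> carrier_mat l l" "- R' \<in> carrier_mat l l"
    using Q' S(1) B(1) R(1) R'(1) by (auto intro: mult_carrier_mat)
  define U where "U = hcat Q\<^sub>1 Q\<^sub>2"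
  have U: "U \<in> carrier_mat n n" unfolding U_def using hcat_carrier[OF Q(1,2)] Q(3) by simp
  have U': "mat_adjoint U \<in> carrier_mat n n" using U by simp
  have UU: "mat_adjoint U * U = 1\<^sub>m n" "U * mat_adjoint U = 1\<^sub>m n"
    using hcat_orthonormal[OF Q(1,2,4,5,6)] hcat_mult_adjoint[OF Q(1,2)] Q(3,8) by (simp_all add: U_def)
  have unitary: "unitary_mat U" using UU U unfolding unitary_mat_def inverts_mat_def by auto
  \<comment> \<open>\<open>F\<close> and \<open>G\<close> are the coefficients of the target pencil;
    it remains to see that \<open>U * F\<close> and \<open>U * G\<close> have the same stacked range
    as \<open>E\<close> and \<open>A\<close>.\<close>
  define F where "F = four_block_mat (mat_adjoint Q\<^sub>1 * S) (0\<^sub>m k l) (mat_adjoint Q\<^sub>2 * S) R"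
  define G where "G = four_block_mat (mat_adjoint Q\<^sub>1 * B) (0\<^sub>m k l) (mat_adjoint Q\<^sub>2 * B) (- R')"
  have FG: "F \<in> carrier_mat n n" "G \<in> carrier_mat n n"
    using four_block_carrier_mat[OF blocks(1,5)] four_block_carrier_mat[OF blocks(2,6)] Q(3)
    by (simp_all add: F_def G_def)
  have UF: "U * F \<in> carrier_mat n n" and UG: "U * G \<in> carrier_mat n n" using U FG by auto
  have Pc: "P \<in> carrier_mat n n" "P' \<in> carrier_mat n n" using P P' by (auto simp: orth_projector_def)
  have UFv: "(U * F) *\<^sub>v (a @\<^sub>v b) = S *\<^sub>v a + P *\<^sub>v (Q\<^sub>2 *\<^sub>v b)"
    and UGv: "(U * G) *\<^sub>v (a @\<^sub>v b) = B *\<^sub>v a - P' *\<^sub>v (Q\<^sub>2 *\<^sub>v b)"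
    if a: "a \<in> carrier_vec k" and b: "b \<in> carrier_vec l" for a b
  proof -
    have "(U * F) *\<^sub>v (a @\<^sub>v b) = S *\<^sub>v a + Q\<^sub>2 *\<^sub>v (R *\<^sub>v b)"
      unfolding U_def F_def by (rule hcat_mult_four_block[OF Q(1,2,8) S(1) R(1) a b])
    also have "Q\<^sub>2 *\<^sub>v (R *\<^sub>v b) = P *\<^sub>v (Q\<^sub>2 *\<^sub>v b)"
      using assoc_mult_mat_vec[OF Q(2) R(1) b] assoc_mult_mat_vec[OF Pc(1) Q(2) b] R(4) by metis
    finally show "(U * F) *\<^sub>v (a @\<^sub>v b) = S *\<^sub>v a + P *\<^sub>v (Q\<^sub>2 *\<^sub>v b)" .
    have "(U * G) *\<^sub>v (a @\<^sub>v b) = B *\<^sub>v a + Q\<^sub>2 *\<^sub>v (- R' *\<^sub>v b)"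
      unfolding U_def G_def by (rule hcat_mult_four_block[OF Q(1,2,8) B(1) blocks(6) a b])
    also have "- R' *\<^sub>v b = - (R' *\<^sub>v b)" using R'(1) b by simp
    also have "Q\<^sub>2 *\<^sub>v (- (R' *\<^sub>v b)) = - (Q\<^sub>2 *\<^sub>v (R' *\<^sub>v b))"
      using Q(2) R'(1) b by (intro eq_vecI) auto
    also have "Q\<^sub>2 *\<^sub>v (R' *\<^sub>v b) = P' *\<^sub>v (Q\<^sub>2 *\<^sub>v b)"
      using assoc_mult_mat_vec[OF Q(2) R'(1) b] assoc_mult_mat_vec[OF Pc(2) Q(2) b] R'(4) by metis
    also have "B *\<^sub>v a + - (P' *\<^sub>v (Q\<^sub>2 *\<^sub>v b)) = B *\<^sub>v a - P' *\<^sub>v (Q\<^sub>2 *\<^sub>v b)"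
      using Pc(2) Q(2) B(1) a b by (intro eq_vecI) auto
    finally show "(U * G) *\<^sub>v (a @\<^sub>v b) = B *\<^sub>v a - P' *\<^sub>v (Q\<^sub>2 *\<^sub>v b)" .
  qed
  have "\<L> O \<D> = {(S *\<^sub>v a + P *\<^sub>v (Q\<^sub>2 *\<^sub>v b), B *\<^sub>v a - P' *\<^sub>v (Q\<^sub>2 *\<^sub>v b)) | a b.
      a \<in> carrier_vec k \<and> b \<in> carrier_vec l}"
    using relation_product_parametrization[OF L D assms(8) Q(2) P[unfolded V_def] R(5)
        P'[unfolded W_def] R'(5) Q(1,9) S B] .
  also have "\<dots> = {((U * F) *\<^sub>v (a @\<^sub>v b), (U * G) *\<^sub>v (a @\<^sub>v b)) | a b.
      a \<in> carrier_vec k \<and> b \<in> carrier_vec l}"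
    by (intro Collect_cong iff_exI) (auto simp: UFv UGv)
  also have "\<dots> = stacked_range n (U * F) (U * G)"
  proof -
    \<comment> \<open>As \<open>k + l = n\<close>, the concatenated parameters run through all
      vectors of length \<open>n\<close>.\<close>
    have "\<exists>a b. v = a @\<^sub>v b \<and> a \<in> carrier_vec k \<and> b \<in> carrier_vec l" if "v \<in> carrier_vec n" for v :: "'a vec"
      using that Q(3) by (intro exI[of _ "vec_first v k"] exI[of _ "vec_last v l"]) simp
    moreover have "a @\<^sub>v b \<in> carrier_vec n" if "a \<in> carrier_vec k" "b \<in> carrier_vec l" for a b :: "'a vec"
      using append_carrier_vec[OF that] Q(3) by simp
    ultimately show ?thesis unfolding stacked_range_def by blast
  qed
  finally have "stacked_range n E A = stacked_range n (U * F) (U * G)" using assms(7) by simp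
  then obtain T where T: "T \<in> carrier_mat n n" "invertible_mat T" "U * F = E * T" "U * G = A * T"
    using equal_stacked_range_right_equivalent[OF E A UF UG] by metis
  have cancel: "mat_adjoint U * X * T = H"
    if X: "X \<in> carrier_mat n n" and H: "H \<in> carrier_mat n n" and eq: "U * H = X * T" for X H
    using assoc_mult_mat[OF U' X T(1)] assoc_mult_mat[OF U' U H] eq UU(1) left_mult_one_mat[OF H] by metis
  note EF = cancel[OF E FG(1) T(3)] and AG = cancel[OF A FG(2) T(4)]
  have form: "const_poly_mat (mat_adjoint U) * pencil E A * const_poly_mat T =
      four_block_mat (pencil (mat_adjoint Q\<^sub>1 * S) (mat_adjoint Q\<^sub>1 * B)) (0\<^sub>m k l)
        (pencil (mat_adjoint Q\<^sub>2 * S) (mat_adjoint Q\<^sub>2 * B)) (pencil R (- R'))"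
    unfolding pencil_mult[OF U' T(1) E A] EF AG F_def G_def by (rule pencil_four_block[OF blocks])
  have "det (mat_adjoint U) * det U = 1" using det_mult[OF U' U] UU(1) by simp
  then have "det (mat_adjoint U) \<noteq> 0" by auto
  then have "regular_pencil E A \<longleftrightarrow> regular_pencil F G"
    using regular_pencil_mult[OF U' T(1) E A _ invertible_det_nonzero[OF T(1,2)]] EF AG by simp
  also have "\<dots> \<longleftrightarrow> regular_pencil (mat_adjoint Q\<^sub>1 * S) (mat_adjoint Q\<^sub>1 * B) \<and> regular_pencil R (- R')"
    unfolding F_def G_def by (rule regular_pencil_four_block[OF blocks])
  \<comment> \<open>First regularity becomes triviality of the common kernel, then the kernel
    condition becomes a statement on the sum of the two subspaces.\<close>
  also have "regular_pencil R (- R') \<longleftrightarrow> subspace_sum V W = mat_range Q\<^sub>2"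
    unfolding regular_projection_pencil[OF R(1-3) R'(1-3)] unfolding R_def R'_def
    by (rule common_kernel_iff_sum[OF V W Q(2,5) Z sub P P'])
  also have "mat_range Q\<^sub>2 = subspace_sum (orth_compl n (Range \<L>)) (orth_compl n (Domain \<D>))"
    unfolding Q(10) by (rule orth_compl_Int[OF vec_subspace_Range[OF L] vec_subspace_Domain[OF D]])
  finally have regular: "regular_pencil E A \<longleftrightarrow>
      regular_pencil (mat_adjoint Q\<^sub>1 * S) (mat_adjoint Q\<^sub>1 * B) \<and>
      subspace_sum (rel_ker n \<L>) (rel_mul n \<D>) =
        subspace_sum (orth_compl n (Range \<L>)) (orth_compl n (Domain \<D>))"
    unfolding V_def W_def .
  have R'_sq: "- R' * - R' = R'"
    using R'(1,3) by (subst uminus_mult_left_mat; simp)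
  have L11: "mat_adjoint Q\<^sub>1 * S = mat_adjoint (mat_adjoint Q\<^sub>1 * S)"
    using symmetric_compression[OF assms(6) S(1) Q(1) S(2)] by simp
  have D11: "neg_semidef_mat (mat_adjoint Q\<^sub>1 * B + mat_adjoint (mat_adjoint Q\<^sub>1 * B))"
    by (rule dissipative_compression[OF assms(4) B(1) Q(1) B(2)])
  have L22: "R = R * R" "R * R = mat_adjoint R" using R(2,3) by simp_all
  have D22: "- (- R') = - R' * - R'" "- R' * - R' = - mat_adjoint (- R')"
    unfolding R'_sq adjoint_uminus R'(2) by simp_all
  \<comment> \<open>The block sizes are the dimension \<open>k\<close> of the space of intermediate
    vectors and the dimension \<open>l\<close> of its complement; either may be zero.\<close>
  show ?thesis
    by (rule exI[of _ U], rule exI[of _ T], rule exI[of _ k], rule exI[of _ l],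
        rule exI[of _ "mat_adjoint Q\<^sub>1 * S"], rule exI[of _ "mat_adjoint Q\<^sub>2 * S"], rule exI[of _ R],
        rule exI[of _ "mat_adjoint Q\<^sub>1 * B"], rule exI[of _ "mat_adjoint Q\<^sub>2 * B"],
        rule exI[of _ "- R'"], intro conjI)
      (fact U unitary T blocks form L11 D11 L22 D22 regular)+
qed

end
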